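(* Let $R$ be a commutative ring with $1$ and let $n$ be a positive integer. (1) Every semiprime left ideal of $M_n(R)$ is equal to the intersection of all prime left ideals of $M_n(R)$ containing it. (2) If $R$ is a Jacobson ring, then every prime left ideal of $M_n(R)$ is equal to the intersection of all maximal left ideals of $M_n(R)$ containing it.
   Context: $M_n(R)$ is the ring of $n\times n$ matrices over $R$. A left ideal $I$ of a ring $S$ with $1$ is prime if for all $x,y\in S$, $xSy\subseteq I$ implies that $xS\subseteq I$ or $y\in I$. A left ideal $I$ of $S$ is semiprime if for all $x\in S$, $xSx\subseteq I$ implies $x\in I$. (Prime and semiprime left ideals are not required to be proper; an intersection over the empty family of left ideals of $S$ is $S$.) A commutative ring is Jacobson if every proper prime ideal is an intersection of maximal ideals. *)

theory Defs
  imports "Jordan_Normal_Form.Matrix" "HOL-Algebra.Ideal"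
begin

section \<open>The matrix ring over a ring with explicit carrier\<close>

text \<open>
  The type \<^typ>\<open>'a mat\<close> only serves as a container of indexed entries here. The arithmetic is that of
  the ring \<open>R\<close>, not the type-class arithmetic on \<^typ>\<open>'a\<close>, so that \<open>R\<close> may be any ring in the sense
  of HOL-Algebra, including the zero ring.
\<close>

definition matrix_ring :: "('a, 'b) ring_scheme \<Rightarrow> nat \<Rightarrow> 'a mat ring" where
  "matrix_ring R n =
    \<lparr>carrier = {A \<in> carrier_mat n n. \<forall>i<n. \<forall>j<n. A $$ (i, j) \<in> carrier R},
     mult = (\<lambda>A B. mat n n (\<lambda>(i, j). \<Oplus>\<^bsub>R\<^esub>k\<in>{..<n}. A $$ (i, k) \<otimes>\<^bsub>R\<^esub> B $$ (k, j))),
     one = mat n n (\<lambda>(i, j). if i = j then \<one>\<^bsub>R\<^esub> else \<zero>\<^bsub>R\<^esub>),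
     zero = mat n n (\<lambda>(i, j). \<zero>\<^bsub>R\<^esub>),
     add = (\<lambda>A B. mat n n (\<lambda>(i, j). A $$ (i, j) \<oplus>\<^bsub>R\<^esub> B $$ (i, j)))\<rparr>"

lemma (in ring) finsum_swap:
  assumes "finite A" "finite B" "\<And>i j. i \<in> A \<Longrightarrow> j \<in> B \<Longrightarrow> f i j \<in> carrier R"
  shows "(\<Oplus>i\<in>A. \<Oplus>j\<in>B. f i j) = (\<Oplus>j\<in>B. \<Oplus>i\<in>A. f i j)"
  using assms(1,3)
proof (induction A rule: finite_induct)
  case empty
  then show ?case by simp
next
  case (insert a A)
  have "(\<Oplus>i\<in>insert a A. \<Oplus>j\<in>B. f i j) = (\<Oplus>j\<in>B. f a j) \<oplus> (\<Oplus>i\<in>A. \<Oplus>j\<in>B. f i j)"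
    using insert by (intro finsum_insert) (auto intro!: finsum_closed)
  also have "\<dots> = (\<Oplus>j\<in>B. f a j) \<oplus> (\<Oplus>j\<in>B. \<Oplus>i\<in>A. f i j)"
    using insert by simp
  also have "\<dots> = (\<Oplus>j\<in>B. f a j \<oplus> (\<Oplus>i\<in>A. f i j))"
    using insert by (intro finsum_addf [symmetric]) (auto intro!: finsum_closed)
  also have "\<dots> = (\<Oplus>j\<in>B. \<Oplus>i\<in>insert a A. f i j)"
    using insert by (intro finsum_cong' refl finsum_insert [symmetric])
      (auto intro!: finsum_closed a_closed)
  finally show ?case .
qed

lemma ring_matrix_ring:
  fixes R (structure)
  assumes "ring R"
  shows "ring (matrix_ring R n)"
proof -
  interpret ring R by fact
  let ?M = "matrix_ring R n"
  have cl: "mat n n (\<lambda>(i, j). f i j) \<in> carrier ?M"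
    if "\<And>i j. i < n \<Longrightarrow> j < n \<Longrightarrow> f i j \<in> carrier R" for f
    using that by (auto simp: matrix_ring_def)
  show ?thesis
  proof (rule ringI)
    show "abelian_group ?M"
    proof (rule abelian_groupI)
      fix A assume A: "A \<in> carrier ?M"
      show "\<exists>B\<in>carrier ?M. B \<oplus>\<^bsub>?M\<^esub> A = \<zero>\<^bsub>?M\<^esub>"
        using A by (intro bexI [of _ "mat n n (\<lambda>(i, j). \<ominus> (A $$ (i, j)))"] cl)
          (auto simp: matrix_ring_def l_neg intro!: eq_matI)
    qed (auto simp: matrix_ring_def a_ac intro!: eq_matI)
    show "Group.monoid ?M"
    proof (rule monoidI)
      fix A B assume "A \<in> carrier ?M" "B \<in> carrier ?M"
      then show "A \<otimes>\<^bsub>?M\<^esub> B \<in> carrier ?M"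
        by (auto simp: matrix_ring_def intro!: finsum_closed)
    next
      show "\<one>\<^bsub>?M\<^esub> \<in> carrier ?M"
        by (auto simp: matrix_ring_def)
    next
      fix A B C
      assume "A \<in> carrier ?M" "B \<in> carrier ?M" "C \<in> carrier ?M"
      then have cl': "\<And>i j. i < n \<Longrightarrow> j < n \<Longrightarrow> A $$ (i, j) \<in> carrier R"
        "\<And>i j. i < n \<Longrightarrow> j < n \<Longrightarrow> B $$ (i, j) \<in> carrier R"
        "\<And>i j. i < n \<Longrightarrow> j < n \<Longrightarrow> C $$ (i, j) \<in> carrier R"
        by (auto simp: matrix_ring_def)
      have "(\<Oplus>k\<in>{..<n}. (\<Oplus>l\<in>{..<n}. A $$ (i, l) \<otimes> B $$ (l, k)) \<otimes> C $$ (k, j)) =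
            (\<Oplus>l\<in>{..<n}. A $$ (i, l) \<otimes> (\<Oplus>k\<in>{..<n}. B $$ (l, k) \<otimes> C $$ (k, j)))"
        if ij: "i < n" "j < n" for i j
      proof -
        have "(\<Oplus>k\<in>{..<n}. (\<Oplus>l\<in>{..<n}. A $$ (i, l) \<otimes> B $$ (l, k)) \<otimes> C $$ (k, j)) =
              (\<Oplus>k\<in>{..<n}. \<Oplus>l\<in>{..<n}. A $$ (i, l) \<otimes> (B $$ (l, k) \<otimes> C $$ (k, j)))"
          using ij cl' by (intro finsum_cong' refl)
            (auto simp: finsum_ldistr m_assoc intro!: finsum_closed finsum_cong')
        also have "\<dots> = (\<Oplus>l\<in>{..<n}. \<Oplus>k\<in>{..<n}. A $$ (i, l) \<otimes> (B $$ (l, k) \<otimes> C $$ (k, j)))"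
          using ij cl' by (intro finsum_swap) auto
        also have "\<dots> = (\<Oplus>l\<in>{..<n}. A $$ (i, l) \<otimes> (\<Oplus>k\<in>{..<n}. B $$ (l, k) \<otimes> C $$ (k, j)))"
          using ij cl' by (intro finsum_cong' refl)
            (auto simp: finsum_rdistr intro!: finsum_closed)
        finally show ?thesis .
      qed
      then show "A \<otimes>\<^bsub>?M\<^esub> B \<otimes>\<^bsub>?M\<^esub> C = A \<otimes>\<^bsub>?M\<^esub> (B \<otimes>\<^bsub>?M\<^esub> C)"
        using cl' by (auto simp: matrix_ring_def intro!: eq_matI cong: finsum_cong)
    next
      fix A assume A: "A \<in> carrier ?M"
      have "(\<Oplus>k\<in>{..<n}. (if i = k then \<one> else \<zero>) \<otimes> A $$ (k, j)) = A $$ (i, j)"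
        if "i < n" "j < n" for i j
      proof -
        have "(\<Oplus>k\<in>{..<n}. (if i = k then \<one> else \<zero>) \<otimes> A $$ (k, j)) =
              (\<Oplus>k\<in>{..<n}. if i = k then A $$ (k, j) else \<zero>)"
          using A that by (intro finsum_cong') (auto simp: matrix_ring_def)
        also have "\<dots> = A $$ (i, j)"
          using A that by (intro finsum_singleton) (auto simp: matrix_ring_def)
        finally show ?thesis .
      qed
      then show "\<one>\<^bsub>?M\<^esub> \<otimes>\<^bsub>?M\<^esub> A = A"
        using A by (auto simp: matrix_ring_def intro!: eq_matI cong: finsum_cong)
    next
      fix A assume A: "A \<in> carrier ?M"
      have "(\<Oplus>k\<in>{..<n}. A $$ (i, k) \<otimes> (if k = j then \<one> else \<zero>)) = A $$ (i, j)"
        if "i < n" "j < n" for i j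
      proof -
        have "(\<Oplus>k\<in>{..<n}. A $$ (i, k) \<otimes> (if k = j then \<one> else \<zero>)) =
              (\<Oplus>k\<in>{..<n}. if j = k then A $$ (i, k) else \<zero>)"
          using A that by (intro finsum_cong') (auto simp: matrix_ring_def)
        also have "\<dots> = A $$ (i, j)"
          using A that by (intro finsum_singleton) (auto simp: matrix_ring_def)
        finally show ?thesis .
      qed
      then show "A \<otimes>\<^bsub>?M\<^esub> \<one>\<^bsub>?M\<^esub> = A"
        using A by (auto simp: matrix_ring_def intro!: eq_matI cong: finsum_cong)
    qed
  next
    fix A B C
    assume "A \<in> carrier ?M" "B \<in> carrier ?M" "C \<in> carrier ?M"
    then have cl': "\<And>i j. i < n \<Longrightarrow> j < n \<Longrightarrow> A $$ (i, j) \<in> carrier R"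
      "\<And>i j. i < n \<Longrightarrow> j < n \<Longrightarrow> B $$ (i, j) \<in> carrier R"
      "\<And>i j. i < n \<Longrightarrow> j < n \<Longrightarrow> C $$ (i, j) \<in> carrier R"
      by (auto simp: matrix_ring_def)
    have "(\<Oplus>k\<in>{..<n}. (A $$ (i, k) \<oplus> B $$ (i, k)) \<otimes> C $$ (k, j)) =
          (\<Oplus>k\<in>{..<n}. A $$ (i, k) \<otimes> C $$ (k, j)) \<oplus> (\<Oplus>k\<in>{..<n}. B $$ (i, k) \<otimes> C $$ (k, j))"
      and "(\<Oplus>k\<in>{..<n}. C $$ (i, k) \<otimes> (A $$ (k, j) \<oplus> B $$ (k, j))) =
          (\<Oplus>k\<in>{..<n}. C $$ (i, k) \<otimes> A $$ (k, j)) \<oplus> (\<Oplus>k\<in>{..<n}. C $$ (i, k) \<otimes> B $$ (k, j))"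
      if "i < n" "j < n" for i j
      using that cl' by (auto simp: l_distr r_distr simp flip: finsum_addf cong: finsum_cong)
    then show "(A \<oplus>\<^bsub>?M\<^esub> B) \<otimes>\<^bsub>?M\<^esub> C = A \<otimes>\<^bsub>?M\<^esub> C \<oplus>\<^bsub>?M\<^esub> B \<otimes>\<^bsub>?M\<^esub> C"
      and "C \<otimes>\<^bsub>?M\<^esub> (A \<oplus>\<^bsub>?M\<^esub> B) = C \<otimes>\<^bsub>?M\<^esub> A \<oplus>\<^bsub>?M\<^esub> C \<otimes>\<^bsub>?M\<^esub> B"
      using cl' by (auto simp: matrix_ring_def intro!: eq_matI cong: finsum_cong)
  qed
qed


section \<open>Left ideals\<close>

locale left_ideal = additive_subgroup I S + ring S for I and S (structure) +
  assumes I_l_closed: "\<lbrakk>a \<in> I; x \<in> carrier S\<rbrakk> \<Longrightarrow> x \<otimes> a \<in> I"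

text \<open>
  Unlike \<^locale>\<open>primeideal\<close>, the next two notions do not require \<open>I \<noteq> carrier S\<close>.
\<close>

locale prime_left_ideal = left_ideal +
  assumes I_prime: "\<lbrakk>x \<in> carrier S; y \<in> carrier S; \<And>s. s \<in> carrier S \<Longrightarrow> x \<otimes> s \<otimes> y \<in> I\<rbrakk>
    \<Longrightarrow> (\<forall>s\<in>carrier S. x \<otimes> s \<in> I) \<or> y \<in> I"

locale semiprime_left_ideal = left_ideal +
  assumes I_semiprime: "\<lbrakk>x \<in> carrier S; \<And>s. s \<in> carrier S \<Longrightarrow> x \<otimes> s \<otimes> x \<in> I\<rbrakk> \<Longrightarrow> x \<in> I"

locale maximal_left_ideal = left_ideal +
  assumes I_notcarr: "carrier S \<noteq> I"
    and I_maximal: "\<lbrakk>left_ideal J S; I \<subseteq> J; J \<subseteq> carrier S\<rbrakk> \<Longrightarrow> J = I \<or> J = carrier S"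


section \<open>Jacobson rings\<close>

text \<open>
  The locale \<^locale>\<open>primeideal\<close> includes properness. Intersecting with the carrier makes the empty
  intersection the whole ring.
\<close>

locale jacobson_ring = cring +
  assumes primeideal_eq_Inter_maximal:
    "primeideal P R \<Longrightarrow> \<exists>F. (\<forall>M\<in>F. maximalideal M R) \<and> P = carrier R \<inter> \<Inter>F"

end

theory Submission
  imports Defs
begin

text \<open>
  A left ideal of the matrix ring is determined by its rows: it consists of all matrices whose rows
  lie in some submodule \<open>N\<close> of \<open>R\<^sup>n\<close>. Under this correspondence a proper left ideal is prime iff \<open>N\<close> is a
  prime submodule, that is, \<open>R\<^sup>n/N\<close> is a torsion-free module over \<open>R/p\<close> for a prime ideal \<open>p\<close>; and it is
  semiprime iff a row \<open>v\<close> lies in \<open>N\<close> as soon as all the multiples of \<open>v\<close> by its own entries do. Each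
  half of the theorem becomes a separation statement: a row outside \<open>N\<close> has to be kept outside a larger
  submodule of the better kind.

  For semiprime \<open>N\<close> and a row \<open>v\<close> outside \<open>N\<close>, the ideal \<open>J = (N : v)\<close> is proper and radical. Let \<open>p\<close> be a
  minimal prime over \<open>J\<close>. Then every element of \<open>p\<close> has a multiple \<open>t a\<close> in \<open>J\<close> with \<open>t\<close> outside \<open>p\<close>
  (\<open>radical_ideal_minimal_prime\<close>). The prime submodule wanted is the contraction of the localization of
  \<open>N + p R\<^sup>n\<close> at \<open>p\<close>. If \<open>v\<close> were in it, then \<open>s v = u + q\<close> with \<open>s\<close> outside \<open>p\<close>, \<open>u\<close> in \<open>N\<close> and the
  entries of \<open>q\<close> in \<open>p\<close>. After multiplication by some \<open>t\<close> outside \<open>p\<close> the entries of \<open>t q\<close> lie in \<open>J\<close>, so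
  they multiply \<open>v\<close>, and hence also \<open>t q = t s v - t u\<close>, into \<open>N\<close>. Semiprimeness puts \<open>t q\<close> into \<open>N\<close>,
  whence \<open>t s v\<close> is in \<open>N\<close> and \<open>t s\<close> is in \<open>p\<close>, which is impossible
  (\<open>semiprime_submodule_separated_by_prime_submodule\<close>).

  For prime \<open>N\<close> and a row \<open>v\<close> outside \<open>N\<close>, linear algebra over the fraction field of \<open>R/p\<close> provides a
  linear form that vanishes on \<open>N\<close> but not at \<open>v\<close>. Clearing denominators makes its values lie in
  \<open>R/p\<close>. The Jacobson property gives a maximal ideal \<open>m\<close> above \<open>p\<close> that misses the value at \<open>v\<close>; the rows on
  which the form takes values in \<open>m/p\<close> are a maximal submodule that contains \<open>N\<close> and not \<open>v\<close>. The form is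
  never written down: \<open>N\<close> is enlarged until \<open>R\<^sup>n/N\<close> has rank one, spanned by \<open>v\<close> up to torsion
  (\<open>prime_submodule_enlarge_rank_one\<close>), and then \<open>r x \<in> N + a v\<close> for a fixed denominator \<open>r\<close> says that
  the form takes the value \<open>a\<close> at \<open>x\<close> (\<open>maximal_submodule_over_maximalideal\<close>). This argument works in
  every finitely generated module.
\<close>

section \<open>Localizing at a minimal prime of a radical ideal\<close>

text \<open>
  The third property says that \<open>J\<close> and \<open>p\<close> agree after localizing at \<open>p\<close>; it makes \<open>p\<close> minimal among the
  primes over \<open>J\<close>. It comes directly from choosing the complement of \<open>p\<close> as a multiplicative set that is
  maximal among those disjoint from \<open>J\<close>: adjoining any further element \<open>a\<close> to it must hit \<open>J\<close>.
\<close>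
lemma (in cring) radical_ideal_minimal_prime:
  assumes "ideal J R" "J \<noteq> carrier R"
    and radical: "\<And>a. a \<in> carrier R \<Longrightarrow> a \<otimes> a \<in> J \<Longrightarrow> a \<in> J"
  obtains p where "primeideal p R" "J \<subseteq> p"
    "\<And>a. a \<in> p \<Longrightarrow> \<exists>t\<in>carrier R - p. t \<otimes> a \<in> J"
proof -
  interpret J: ideal J R by fact
  define \<T> where "\<T> = {T. T \<subseteq> carrier R \<and> \<one> \<in> T \<and> (\<forall>a\<in>T. \<forall>b\<in>T. a \<otimes> b \<in> T) \<and> T \<inter> J = {}}"
  have "{\<one>} \<in> \<T>"
    using assms(2) J.one_imp_carrier by (auto simp: \<T>_def)
  moreover have "\<Union>\<C> \<in> \<T>" if "\<C> \<noteq> {}" and chain: "subset.chain \<T> \<C>" for \<C>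
  proof -
    have sub: "\<C> \<subseteq> \<T>" and lin: "\<And>S T. S \<in> \<C> \<Longrightarrow> T \<in> \<C> \<Longrightarrow> S \<subseteq> T \<or> T \<subseteq> S"
      using chain by (auto simp: subset.chain_def)
    have "a \<otimes> b \<in> \<Union>\<C>" if "a \<in> S" "b \<in> T" "S \<in> \<C>" "T \<in> \<C>" for a b S T
    proof -
      have "S \<subseteq> T \<or> T \<subseteq> S" "S \<in> \<T>" "T \<in> \<T>" using lin sub that by auto
      then have "a \<otimes> b \<in> S \<or> a \<otimes> b \<in> T"
        using that(1,2) by (auto simp: \<T>_def)
      with that(3,4) show ?thesis by blast
    qed
    then have "\<forall>a\<in>\<Union>\<C>. \<forall>b\<in>\<Union>\<C>. a \<otimes> b \<in> \<Union>\<C>"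
      by (intro ballI) (elim UnionE)
    moreover have "\<forall>S\<in>\<C>. S \<subseteq> carrier R \<and> \<one> \<in> S \<and> S \<inter> J = {}"
      using sub by (auto simp: \<T>_def)
    then have "\<Union>\<C> \<subseteq> carrier R" "\<one> \<in> \<Union>\<C>" "\<Union>\<C> \<inter> J = {}"
      using \<open>\<C> \<noteq> {}\<close> by auto
    ultimately show ?thesis by (simp add: \<T>_def)
  qed
  ultimately obtain T where T: "T \<in> \<T>" and max: "\<And>T'. T' \<in> \<T> \<Longrightarrow> T \<subseteq> T' \<Longrightarrow> T' = T"
    using subset_Zorn_nonempty [of \<T>] by blast
  have sub: "T \<subseteq> carrier R" and one: "\<one> \<in> T" and mult: "\<And>a b. a \<in> T \<Longrightarrow> b \<in> T \<Longrightarrow> a \<otimes> b \<in> T"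
    and disj: "T \<inter> J = {}"
    using T by (auto simp: \<T>_def)
  have radical_pow: "a \<in> J" if "a \<in> carrier R" "a [^] Suc k \<in> J" for a and k :: nat
    using that(2)
  proof (induction k)
    case 0
    then show ?case using that(1) by simp
  next
    case (Suc k)
    have "a [^] Suc k \<otimes> a [^] Suc k = a [^] k \<otimes> a [^] Suc (Suc k)"
      using that(1) by (simp add: m_ac)
    also have "\<dots> \<in> J"
      using Suc.prems that(1) by (intro J.I_l_closed) auto
    finally have "a [^] Suc k \<in> J" using that(1) by (intro radical [of "a [^] Suc k"]) auto
    then show ?case by (rule Suc.IH)
  qed
  have absorb: "\<exists>t\<in>T. t \<otimes> a \<in> J" if a: "a \<in> carrier R" "a \<notin> T" for a
  proof -
    \<comment> \<open>the multiplicative set generated by \<open>T\<close> and \<open>a\<close>\<close>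
    define T' where "T' = {t \<otimes> a [^] k | t k. t \<in> T \<and> k \<in> (UNIV :: nat set)}"
    have memT': "t \<otimes> a [^] k \<in> T'" if "t \<in> T" for t and k :: nat
      using that unfolding T'_def by blast
    have "T \<subseteq> T'"
    proof
      fix t assume "t \<in> T"
      then show "t \<in> T'" using memT' [of t 0] sub by auto
    qed
    moreover have "a \<in> T'"
      using memT' [OF one, of 1] a by simp
    ultimately have "T' \<notin> \<T>"
      using max a by blast
    moreover have "T' \<subseteq> carrier R"
      using sub a by (auto simp: T'_def)
    moreover have "x \<otimes> y \<in> T'" if "x \<in> T'" "y \<in> T'" for x y
    proof -
      obtain s t and k l :: nat where st: "s \<in> T" "t \<in> T"
        and xy: "x = s \<otimes> a [^] k" "y = t \<otimes> a [^] l"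
        using \<open>x \<in> T'\<close> \<open>y \<in> T'\<close> by (auto simp: T'_def)
      have cl: "s \<in> carrier R" "t \<in> carrier R" "a [^] k \<in> carrier R" "a [^] l \<in> carrier R"
        using st sub a by auto
      then have "x \<otimes> y = (s \<otimes> t) \<otimes> (a [^] k \<otimes> a [^] l)"
        unfolding xy by (simp add: m_ac)
      also have "\<dots> = (s \<otimes> t) \<otimes> a [^] (k + l)"
        using a by (simp add: nat_pow_mult)
      finally show ?thesis using memT' [OF mult, OF st] by simp
    qed
    ultimately have "T' \<inter> J \<noteq> {}"
      using \<open>T \<subseteq> T'\<close> one by (auto simp: \<T>_def)
    then obtain t and k :: nat where tk: "t \<in> T" "t \<otimes> a [^] k \<in> J"
      by (auto simp: T'_def)
    have t: "t \<in> carrier R" using tk sub by auto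
    \<comment> \<open>radicality replaces \<open>t a\<^sup>k\<close> by \<open>t a\<close>; the exponent \<open>k + 1\<close> avoids the case \<open>k = 0\<close>\<close>
    have "(t \<otimes> a) [^] Suc k = (t [^] k \<otimes> (t \<otimes> a [^] k)) \<otimes> a"
      using t a by (simp add: nat_pow_distrib m_ac)
    also have "\<dots> \<in> J"
      using tk t a by (auto intro: J.I_r_closed [OF J.I_l_closed])
    finally have "t \<otimes> a \<in> J"
      by (rule radical_pow [OF m_closed [OF t a(1)]])
    with tk show ?thesis by blast
  qed
  define p where "p = carrier R - T"
  have p_iff: "a \<in> p \<longleftrightarrow> (\<exists>t\<in>T. t \<otimes> a \<in> J)" if "a \<in> carrier R" for a
    using absorb that mult disj by (auto simp: p_def)
  have psub: "p \<subseteq> carrier R" by (auto simp: p_def)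
  have prod: "t \<otimes> (x \<otimes> a) \<in> J" if "t \<in> T" "t \<otimes> a \<in> J" "x \<in> carrier R" "a \<in> carrier R" for t x a
  proof -
    have "t \<otimes> (x \<otimes> a) = x \<otimes> (t \<otimes> a)"
      using that sub by (auto simp: m_ac)
    then show ?thesis using that J.I_l_closed by simp
  qed
  have mult_p: "x \<otimes> a \<in> p" if ap: "a \<in> p" and x: "x \<in> carrier R" for a x
  proof -
    have a: "a \<in> carrier R" using ap psub by blast
    then obtain t where t: "t \<in> T" "t \<otimes> a \<in> J" using p_iff ap by blast
    then have "t \<otimes> (x \<otimes> a) \<in> J" using prod x a by blast
    then show ?thesis using p_iff [OF m_closed [OF x a]] t by blast
  qed
  have "ideal p R"
  proof (intro idealI ring_axioms)
    show "subgroup p (add_monoid R)"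
    proof (rule add.subgroupI)
      show "p \<subseteq> carrier R" by fact
      have "\<zero> \<in> p" using disj by (auto simp: p_def)
      then show "p \<noteq> {}" by blast
      fix a assume a: "a \<in> p"
      have "\<ominus> a = \<ominus> \<one> \<otimes> a" using a psub by (auto simp: l_minus)
      then show "\<ominus> a \<in> p" using mult_p [OF a, of "\<ominus> \<one>"] by simp
      fix b assume b: "b \<in> p"
      have "\<exists>s\<in>T. s \<otimes> a \<in> J" "\<exists>t\<in>T. t \<otimes> b \<in> J"
        using a b p_iff [of a] p_iff [of b] psub by auto
      then obtain s t where st: "s \<in> T" "t \<in> T" "s \<otimes> a \<in> J" "t \<otimes> b \<in> J"
        by blast
      have cl: "s \<in> carrier R" "t \<in> carrier R" "a \<in> carrier R" "b \<in> carrier R"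
        using st a b sub psub by auto
      have "(s \<otimes> t) \<otimes> (a \<oplus> b) = t \<otimes> (s \<otimes> a) \<oplus> s \<otimes> (t \<otimes> b)"
        using cl by (simp add: m_ac r_distr)
      also have "\<dots> \<in> J" using st cl by (intro J.a_closed) (auto intro: J.I_l_closed)
      finally show "a \<oplus> b \<in> p" using p_iff [of "a \<oplus> b"] cl mult [OF st(1,2)] by auto
    qed
  qed (use mult_p psub m_comm in \<open>auto simp: subset_iff\<close>)
  then have "primeideal p R"
  proof (rule primeidealI [OF _ cring_axioms])
    show "carrier R \<noteq> p" using one sub by (auto simp: p_def)
    show "a \<in> p \<or> b \<in> p" if "a \<in> carrier R" "b \<in> carrier R" "a \<otimes> b \<in> p" for a b
      using that mult by (auto simp: p_def)
  qed
  moreover have "J \<subseteq> p" using disj J.a_subset by (auto simp: p_def)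
  moreover have "\<exists>t\<in>carrier R - p. t \<otimes> a \<in> J" if "a \<in> p" for a
  proof -
    have "\<exists>t\<in>T. t \<otimes> a \<in> J" using that p_iff [of a] psub by auto
    then show ?thesis using sub by (auto simp: p_def)
  qed
  ultimately show ?thesis using that by blast
qed

lemma (in cring) common_multiplier_into_ideal:
  fixes m :: nat
  assumes p: "primeideal p R" and J: "ideal J R"
    and "\<And>j. j < m \<Longrightarrow> q j \<in> carrier R \<and> (\<exists>t\<in>carrier R - p. t \<otimes> q j \<in> J)"
  shows "\<exists>t\<in>carrier R - p. \<forall>j<m. t \<otimes> q j \<in> J"
  using assms(3)
proof (induction m)
  interpret p: primeideal p R by fact
  case 0
  then show ?case using p.one_imp_carrier p.I_notcarr by auto
next
  interpret p: primeideal p R by fact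
  interpret J: ideal J R by fact
  case (Suc m)
  obtain s where s: "s \<in> carrier R - p" "\<forall>j<m. s \<otimes> q j \<in> J"
    using Suc.IH Suc.prems less_SucI by blast
  obtain t where t: "t \<in> carrier R - p" "t \<otimes> q m \<in> J" "q m \<in> carrier R"
    using Suc.prems by blast
  have "(t \<otimes> s) \<otimes> q j \<in> J" if "j < Suc m" for j
  proof (cases "j = m")
    case True
    have "(t \<otimes> s) \<otimes> q m = s \<otimes> (t \<otimes> q m)" using s t by (simp add: m_ac)
    then show ?thesis using True s t J.I_l_closed by auto
  next
    case False
    then have "j < m" using that by simp
    then have "(t \<otimes> s) \<otimes> q j = t \<otimes> (s \<otimes> q j)" "s \<otimes> q j \<in> J"
      using s t Suc.prems by (auto simp: m_assoc)
    then show ?thesis using t J.I_l_closed by auto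
  qed
  moreover have "t \<otimes> s \<in> carrier R - p" using s t p.I_prime by auto
  ultimately show ?case by blast
qed

section \<open>Prime submodules\<close>

context module
begin

lemma submodule_zero: "submodule N R M \<Longrightarrow> \<zero>\<^bsub>M\<^esub> \<in> N"
  using subgroup.one_closed [OF submodule.axioms(1)] by force

lemma submoduleI':
  assumes "H \<subseteq> carrier M" "\<zero>\<^bsub>M\<^esub> \<in> H"
    and "\<And>x y. \<lbrakk>x \<in> H; y \<in> H\<rbrakk> \<Longrightarrow> x \<oplus>\<^bsub>M\<^esub> y \<in> H"
    and "\<And>a x. \<lbrakk>a \<in> carrier R; x \<in> H\<rbrakk> \<Longrightarrow> a \<odot>\<^bsub>M\<^esub> x \<in> H"
  shows "submodule H R M"
proof (rule submoduleI)
  show "\<ominus>\<^bsub>M\<^esub> x \<in> H" if "x \<in> H" for x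
    using assms(4) [of "\<ominus> \<one>" x] assms(1) that smult_l_minus [of \<one> x] by auto
qed (use assms in auto)

lemma submodule_diff:
  assumes "submodule N R M" "x \<oplus>\<^bsub>M\<^esub> y \<in> N" "x \<in> N" "y \<in> carrier M"
  shows "y \<in> N"
proof -
  have x: "x \<in> carrier M" using assms submoduleE(1) by blast
  have "\<ominus>\<^bsub>M\<^esub> x \<oplus>\<^bsub>M\<^esub> (x \<oplus>\<^bsub>M\<^esub> y) \<in> N"
    using submoduleE(3,5) [OF assms(1)] assms by blast
  then show ?thesis using x assms by (simp add: M.r_neg1)
qed

text \<open>The ideal usually written \<open>(N : X)\<close>.\<close>
lemma ideal_transporter:
  assumes N: "submodule N R M" and X: "X \<subseteq> carrier M"
  shows "ideal {a \<in> carrier R. \<forall>x\<in>X. a \<odot>\<^bsub>M\<^esub> x \<in> N} R"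
proof -
  note cl = submoduleE [OF N]
  have Xc: "x \<in> carrier M" if "x \<in> X" for x using that X by blast
  have mult: "b \<otimes> a \<in> {a \<in> carrier R. \<forall>x\<in>X. a \<odot>\<^bsub>M\<^esub> x \<in> N}"
    if "a \<in> {a \<in> carrier R. \<forall>x\<in>X. a \<odot>\<^bsub>M\<^esub> x \<in> N}" "b \<in> carrier R" for a b
    using that Xc cl(4) by (simp add: smult_assoc1)
  show ?thesis
  proof (intro idealI R.ring_axioms)
    show "subgroup {a \<in> carrier R. \<forall>x\<in>X. a \<odot>\<^bsub>M\<^esub> x \<in> N} (add_monoid R)"
    proof (rule R.add.subgroupI)
      have "\<zero> \<in> {a \<in> carrier R. \<forall>x\<in>X. a \<odot>\<^bsub>M\<^esub> x \<in> N}"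
        using Xc submodule_zero [OF N] by simp
      then show "{a \<in> carrier R. \<forall>x\<in>X. a \<odot>\<^bsub>M\<^esub> x \<in> N} \<noteq> {}" by blast
    qed (use Xc cl(3,5) in \<open>auto simp: smult_l_minus smult_l_distr\<close>)
  next
    fix a b assume ab: "a \<in> {a \<in> carrier R. \<forall>x\<in>X. a \<odot>\<^bsub>M\<^esub> x \<in> N}" "b \<in> carrier R"
    then show "b \<otimes> a \<in> {a \<in> carrier R. \<forall>x\<in>X. a \<odot>\<^bsub>M\<^esub> x \<in> N}"
      by (rule mult)
    then show "a \<otimes> b \<in> {a \<in> carrier R. \<forall>x\<in>X. a \<odot>\<^bsub>M\<^esub> x \<in> N}"
      using ab by (simp add: R.m_comm)
  qed
qed

text \<open>
  For a prime ideal \<open>p\<close> this says that \<open>M/N\<close> is a torsion-free module over \<open>R/p\<close>. The case \<open>N = M\<close> is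
  admitted, just as prime left ideals may be improper; for proper \<open>N\<close> the ideal \<open>p\<close> is forced to be
  \<open>(N : M)\<close>.
\<close>
definition prime_submodule :: "'a set \<Rightarrow> 'c set \<Rightarrow> bool" where
  "prime_submodule p N \<longleftrightarrow> submodule N R M \<and>
     (\<forall>a\<in>p. \<forall>x\<in>carrier M. a \<odot>\<^bsub>M\<^esub> x \<in> N) \<and>
     (\<forall>a\<in>carrier R. \<forall>x\<in>carrier M. a \<odot>\<^bsub>M\<^esub> x \<in> N \<longrightarrow> a \<in> p \<or> x \<in> N)"

text \<open>
  Recovers \<open>p\<close> from a primeness condition that does not mention it, which is the form in which the condition
  comes out of a prime left ideal.
\<close>
lemma prime_submodule_transporter:
  assumes N: "submodule N R M" and "N \<noteq> carrier M"
    and prime: "\<And>a x. a \<in> carrier R \<Longrightarrow> x \<in> carrier M \<Longrightarrow> a \<odot>\<^bsub>M\<^esub> x \<in> N \<Longrightarrow>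
      x \<in> N \<or> (\<forall>y\<in>carrier M. a \<odot>\<^bsub>M\<^esub> y \<in> N)"
  defines "p \<equiv> {a \<in> carrier R. \<forall>y\<in>carrier M. a \<odot>\<^bsub>M\<^esub> y \<in> N}"
  shows "primeideal p R" "prime_submodule p N"
proof -
  obtain v where v: "v \<in> carrier M" "v \<notin> N"
    using assms(2) submoduleE(1) [OF N] by blast
  show "primeideal p R"
  proof (rule primeidealI [OF _ R.cring_axioms])
    show "ideal p R" unfolding p_def by (rule ideal_transporter [OF N subset_refl])
    have "\<one> \<notin> p" using v smult_one [OF v(1)] unfolding p_def by auto
    then show "carrier R \<noteq> p" by blast
    fix a b assume ab: "a \<in> carrier R" "b \<in> carrier R" "a \<otimes> b \<in> p"
    show "a \<in> p \<or> b \<in> p"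
    proof (rule disjCI)
      assume "b \<notin> p"
      then obtain y where y: "y \<in> carrier M" "b \<odot>\<^bsub>M\<^esub> y \<notin> N" using ab by (auto simp: p_def)
      moreover have "a \<odot>\<^bsub>M\<^esub> (b \<odot>\<^bsub>M\<^esub> y) \<in> N"
        using ab y by (simp add: p_def flip: smult_assoc1)
      ultimately show "a \<in> p" using prime [of a "b \<odot>\<^bsub>M\<^esub> y"] ab by (auto simp: p_def)
    qed
  qed
  show "prime_submodule p N"
    unfolding prime_submodule_def p_def using N prime by blast
qed

text \<open>The preimage in \<open>M\<close> of the localization \<open>L\<^sub>p\<close>, a submodule of \<open>M\<^sub>p\<close>.\<close>
definition saturation :: "'a set \<Rightarrow> 'c set \<Rightarrow> 'c set" where
  "saturation p L = {x \<in> carrier M. \<exists>t\<in>carrier R - p. t \<odot>\<^bsub>M\<^esub> x \<in> L}"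

lemma saturationI:
  "t \<in> carrier R - p \<Longrightarrow> t \<odot>\<^bsub>M\<^esub> x \<in> L \<Longrightarrow> x \<in> carrier M \<Longrightarrow> x \<in> saturation p L"
  unfolding saturation_def by blast

text \<open>
  Localizing at \<open>p\<close> turns \<open>M/L\<close> into a vector space over the residue field of \<open>p\<close>, and inverting the
  elements outside \<open>p\<close> is exactly what removes torsion.
\<close>
lemma prime_submodule_saturation:
  assumes "primeideal p R" and L: "submodule L R M"
    and pL: "\<And>a x. a \<in> p \<Longrightarrow> x \<in> carrier M \<Longrightarrow> a \<odot>\<^bsub>M\<^esub> x \<in> L"
  shows "prime_submodule p (saturation p L)"
proof -
  interpret p: primeideal p R by fact
  note Lcl = submoduleE [OF L]
  have one: "\<one> \<in> carrier R - p" using p.one_imp_carrier p.I_notcarr by auto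
  have prod: "s \<otimes> t \<in> carrier R - p" if "s \<in> carrier R - p" "t \<in> carrier R - p" for s t
    using p.I_prime that by auto
  have incl: "x \<in> saturation p L" if "x \<in> carrier M" "x \<in> L" for x
    using that one by (auto simp: saturation_def intro!: bexI [of _ \<one>])
  have "submodule (saturation p L) R M"
  proof (rule submoduleI')
    show "saturation p L \<subseteq> carrier M" by (auto simp: saturation_def)
    show "\<zero>\<^bsub>M\<^esub> \<in> saturation p L" using incl submodule_zero [OF L] by auto
  next
    fix x y assume "x \<in> saturation p L" "y \<in> saturation p L"
    then obtain s t where st: "s \<in> carrier R - p" "t \<in> carrier R - p" "s \<odot>\<^bsub>M\<^esub> x \<in> L" "t \<odot>\<^bsub>M\<^esub> y \<in> L"
      and x: "x \<in> carrier M" "y \<in> carrier M"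
      by (auto simp: saturation_def)
    have "(s \<otimes> t) \<odot>\<^bsub>M\<^esub> (x \<oplus>\<^bsub>M\<^esub> y) = (t \<otimes> s) \<odot>\<^bsub>M\<^esub> x \<oplus>\<^bsub>M\<^esub> (s \<otimes> t) \<odot>\<^bsub>M\<^esub> y"
      using st x by (simp add: smult_r_distr R.m_comm)
    also have "\<dots> = t \<odot>\<^bsub>M\<^esub> (s \<odot>\<^bsub>M\<^esub> x) \<oplus>\<^bsub>M\<^esub> s \<odot>\<^bsub>M\<^esub> (t \<odot>\<^bsub>M\<^esub> y)"
      using st x by (simp add: smult_assoc1)
    also have "\<dots> \<in> L" using st Lcl(4,5) by auto
    finally show "x \<oplus>\<^bsub>M\<^esub> y \<in> saturation p L"
      using prod [OF st(1,2)] x by (intro saturationI) auto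
  next
    fix a x assume a: "a \<in> carrier R" and "x \<in> saturation p L"
    then obtain t where t: "t \<in> carrier R - p" "t \<odot>\<^bsub>M\<^esub> x \<in> L" and x: "x \<in> carrier M"
      by (auto simp: saturation_def)
    have "t \<odot>\<^bsub>M\<^esub> (a \<odot>\<^bsub>M\<^esub> x) = a \<odot>\<^bsub>M\<^esub> (t \<odot>\<^bsub>M\<^esub> x)"
      using t x a by (simp add: R.m_comm flip: smult_assoc1)
    then show "a \<odot>\<^bsub>M\<^esub> x \<in> saturation p L"
      using t x a Lcl(4) by (intro saturationI [of t]) auto
  qed
  moreover have "a \<odot>\<^bsub>M\<^esub> x \<in> saturation p L" if "a \<in> p" "x \<in> carrier M" for a x
    using that p.a_Hcarr by (intro incl pL smult_closed)
  moreover have "a \<in> p \<or> x \<in> saturation p L"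
    if a: "a \<in> carrier R" and x: "x \<in> carrier M" and ax: "a \<odot>\<^bsub>M\<^esub> x \<in> saturation p L" for a x
  proof -
    obtain t where t: "t \<in> carrier R - p" "t \<odot>\<^bsub>M\<^esub> (a \<odot>\<^bsub>M\<^esub> x) \<in> L"
      using ax unfolding saturation_def by blast
    then have "(t \<otimes> a) \<odot>\<^bsub>M\<^esub> x \<in> L" using a x by (simp add: smult_assoc1)
    moreover have "t \<otimes> a \<in> carrier R - p" if "a \<notin> p"
      using prod t a that by auto
    ultimately show ?thesis using x saturationI by blast
  qed
  ultimately show ?thesis
    by (simp add: prime_submodule_def)
qed

end

section \<open>Prime submodules over Jacobson rings\<close>

text \<open>Every nonzero element of the field \<open>R/m\<close> is invertible.\<close>
lemma (in cring) maximalideal_inverse: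
  assumes "maximalideal m R" "a \<in> carrier R" "a \<notin> m"
  obtains b \<mu> where "b \<in> carrier R" "\<mu> \<in> m" "\<one> = \<mu> \<oplus> b \<otimes> a"
proof -
  interpret m: maximalideal m R by fact
  have PI: "ideal (PIdl a) R" using assms cgenideal_ideal by blast
  have J: "ideal (m <+>\<^bsub>R\<^esub> PIdl a) R"
    using add_ideals [OF m.is_ideal PI] .
  have "x \<in> m <+>\<^bsub>R\<^esub> PIdl a" if "x \<in> m" for x
  proof -
    have "x = x \<oplus> \<zero>" using that m.a_Hcarr by simp
    then show ?thesis
      using that additive_subgroup.zero_closed [OF ideal.axioms(1) [OF PI]]
      unfolding AbelCoset.set_add_def' by blast
  qed
  moreover have "a \<in> m <+>\<^bsub>R\<^esub> PIdl a"
  proof -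
    have "a = \<zero> \<oplus> a" using assms by simp
    then show ?thesis
      using cgenideal_self [OF assms(2)] m.zero_closed unfolding AbelCoset.set_add_def' by blast
  qed
  moreover have "m <+>\<^bsub>R\<^esub> PIdl a \<subseteq> carrier R"
    using J by (simp add: additive_subgroup.a_subset ideal.axioms(1))
  ultimately have "m <+>\<^bsub>R\<^esub> PIdl a = carrier R"
    using m.I_maximal [OF J] assms by blast
  then have "\<one> \<in> m <+>\<^bsub>R\<^esub> PIdl a" by simp
  then show ?thesis using that unfolding AbelCoset.set_add_def' cgenideal_def by blast
qed

context module
begin

definition adjoin_multiples :: "'c set \<Rightarrow> 'a set \<Rightarrow> 'c \<Rightarrow> 'c set" where
  "adjoin_multiples N A v = {u \<oplus>\<^bsub>M\<^esub> a \<odot>\<^bsub>M\<^esub> v | u a. u \<in> N \<and> a \<in> A}"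

lemma submodule_adjoin_multiples:
  assumes N: "submodule N R M" and "ideal A R" and v: "v \<in> carrier M"
  shows "submodule (adjoin_multiples N A v) R M"
proof -
  interpret A: ideal A R by fact
  note Ncl = submoduleE [OF N]
  have mem: "x \<in> adjoin_multiples N A v"
    if "x = u \<oplus>\<^bsub>M\<^esub> a \<odot>\<^bsub>M\<^esub> v" "u \<in> N" "a \<in> A" for x u a
    using that unfolding adjoin_multiples_def by blast
  show ?thesis
  proof (rule submoduleI')
    show "adjoin_multiples N A v \<subseteq> carrier M"
      using Ncl(1) v by (auto simp: adjoin_multiples_def)
    show "\<zero>\<^bsub>M\<^esub> \<in> adjoin_multiples N A v"
      by (rule mem [of _ "\<zero>\<^bsub>M\<^esub>" \<zero>]) (use v submodule_zero [OF N] in auto)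
  next
    fix x y assume "x \<in> adjoin_multiples N A v" "y \<in> adjoin_multiples N A v"
    then obtain u a u' a' where *: "u \<in> N" "a \<in> A" "u' \<in> N" "a' \<in> A"
      "x = u \<oplus>\<^bsub>M\<^esub> a \<odot>\<^bsub>M\<^esub> v" "y = u' \<oplus>\<^bsub>M\<^esub> a' \<odot>\<^bsub>M\<^esub> v"
      by (auto simp: adjoin_multiples_def)
    moreover have "u \<in> carrier M" "u' \<in> carrier M" using * Ncl(1) by auto
    ultimately show "x \<oplus>\<^bsub>M\<^esub> y \<in> adjoin_multiples N A v"
      using v Ncl(5) by (intro mem [of _ "u \<oplus>\<^bsub>M\<^esub> u'" "a \<oplus> a'"]) (auto simp: smult_l_distr M.a_ac)
  next
    fix r x assume r: "r \<in> carrier R" and "x \<in> adjoin_multiples N A v"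
    then obtain u a where *: "u \<in> N" "a \<in> A" "x = u \<oplus>\<^bsub>M\<^esub> a \<odot>\<^bsub>M\<^esub> v"
      by (auto simp: adjoin_multiples_def)
    moreover have "u \<in> carrier M" using * Ncl(1) by auto
    ultimately show "r \<odot>\<^bsub>M\<^esub> x \<in> adjoin_multiples N A v"
      using v r Ncl(4) by (intro mem [of _ "r \<odot>\<^bsub>M\<^esub> u" "r \<otimes> a"])
        (auto simp: smult_r_distr smult_assoc1 A.I_l_closed)
  qed
qed

text \<open>
  Applied to \<open>N + A v\<close>, this shows that the elements whose \<open>r\<close>-multiple has its \<open>v\<close>-coordinate in the
  ideal \<open>A\<close> form a submodule.
\<close>
lemma submodule_multiplier_preimage:
  assumes L: "submodule L R M" and r: "r \<in> carrier R"
  shows "submodule {x \<in> carrier M. r \<odot>\<^bsub>M\<^esub> x \<in> L} R M"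
proof (rule submoduleI')
  fix a x assume "a \<in> carrier R" and x: "x \<in> {x \<in> carrier M. r \<odot>\<^bsub>M\<^esub> x \<in> L}"
  moreover from this have "r \<odot>\<^bsub>M\<^esub> (a \<odot>\<^bsub>M\<^esub> x) = a \<odot>\<^bsub>M\<^esub> (r \<odot>\<^bsub>M\<^esub> x)"
    using r by (simp add: R.m_comm flip: smult_assoc1)
  ultimately show "a \<odot>\<^bsub>M\<^esub> x \<in> {x \<in> carrier M. r \<odot>\<^bsub>M\<^esub> x \<in> L}"
    using r submoduleE(4) [OF L] by auto
qed (use r submodule_zero [OF L] submoduleE(5) [OF L] in \<open>auto simp: smult_r_distr\<close>)

definition maximal_submodule :: "'c set \<Rightarrow> bool" where
  "maximal_submodule L \<longleftrightarrow> submodule L R M \<and> L \<noteq> carrier M \<and>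
     (\<forall>J. submodule J R M \<longrightarrow> L \<subseteq> J \<longrightarrow> J = L \<or> J = carrier M)"

text \<open>
  Over the fraction field of \<open>R/p\<close> the conclusion says that every \<open>e\<close> becomes a scalar multiple of \<open>v\<close>
  modulo \<open>N'\<close>. The elements of \<open>E\<close> are treated one after the other: \<open>e\<close> is added to the submodule,
  which is then saturated, unless this would swallow \<open>v\<close>; in that case a relation \<open>t v = u + r e\<close>
  expresses \<open>e\<close> through \<open>v\<close>.
\<close>
lemma prime_submodule_enlarge_rank_one:
  assumes p: "primeideal p R" and N: "prime_submodule p N"
    and v: "v \<in> carrier M" "v \<notin> N"
    and "finite E" "E \<subseteq> carrier M"
  obtains N' where "prime_submodule p N'" "N \<subseteq> N'" "v \<notin> N'"
    "\<And>e. e \<in> E \<Longrightarrow> \<exists>r\<in>carrier R - p. r \<odot>\<^bsub>M\<^esub> e \<in> adjoin_multiples N' (carrier R) v"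
proof -
  interpret p: primeideal p R by fact
  have one: "\<one> \<in> carrier R - p" using p.one_imp_carrier p.I_notcarr by auto
  have "\<exists>N'. prime_submodule p N' \<and> N \<subseteq> N' \<and> v \<notin> N' \<and>
    (\<forall>e\<in>E. \<exists>r\<in>carrier R - p. r \<odot>\<^bsub>M\<^esub> e \<in> adjoin_multiples N' (carrier R) v)"
    using assms(5,6)
  proof (induction E rule: finite_induct)
    case empty
    then show ?case using N v by auto
  next
    case (insert e E)
    then obtain N' where N': "prime_submodule p N'" "N \<subseteq> N'" "v \<notin> N'"
      and E: "\<And>e. e \<in> E \<Longrightarrow> \<exists>r\<in>carrier R - p. r \<odot>\<^bsub>M\<^esub> e \<in> adjoin_multiples N' (carrier R) v"
      by auto
    have e: "e \<in> carrier M" using insert by auto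
    have sub: "submodule N' R M" using N' by (simp add: prime_submodule_def)
    note cl = submoduleE [OF sub]
    define L where "L = adjoin_multiples N' (carrier R) e"
    have L: "submodule L R M"
      unfolding L_def by (intro submodule_adjoin_multiples sub R.oneideal e)
    have NL: "N' \<subseteq> L"
    proof
      fix x assume "x \<in> N'"
      moreover from this have "x = x \<oplus>\<^bsub>M\<^esub> \<zero> \<odot>\<^bsub>M\<^esub> e" using e cl(1) by auto
      ultimately show "x \<in> L" unfolding L_def adjoin_multiples_def by blast
    qed
    show ?case
    proof (cases "v \<in> saturation p L")
      case False
      have "N' \<subseteq> saturation p L"
        using NL one cl(1) by (force simp: saturation_def intro!: bexI [of _ \<one>])
      moreover have "prime_submodule p (saturation p L)"
        using N' NL by (intro prime_submodule_saturation p L) (auto simp: prime_submodule_def)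
      moreover have "e \<in> saturation p L"
      proof -
        have "\<one> \<odot>\<^bsub>M\<^esub> e = \<zero>\<^bsub>M\<^esub> \<oplus>\<^bsub>M\<^esub> \<one> \<odot>\<^bsub>M\<^esub> e" using e by simp
        then have "\<one> \<odot>\<^bsub>M\<^esub> e \<in> L"
          using submodule_zero [OF sub] unfolding L_def adjoin_multiples_def by blast
        then show ?thesis using e one saturationI by blast
      qed
      moreover have "\<exists>r\<in>carrier R - p. r \<odot>\<^bsub>M\<^esub> x \<in> adjoin_multiples (saturation p L) (carrier R) v"
        if "x \<in> E" for x
        using E [OF that] \<open>N' \<subseteq> saturation p L\<close> unfolding adjoin_multiples_def by blast
      moreover have "\<exists>r\<in>carrier R - p. r \<odot>\<^bsub>M\<^esub> e \<in> adjoin_multiples (saturation p L) (carrier R) v"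
      proof (rule bexI [OF _ one])
        have "\<one> \<odot>\<^bsub>M\<^esub> e = e \<oplus>\<^bsub>M\<^esub> \<zero> \<odot>\<^bsub>M\<^esub> v" using e v by simp
        then show "\<one> \<odot>\<^bsub>M\<^esub> e \<in> adjoin_multiples (saturation p L) (carrier R) v"
          using \<open>e \<in> saturation p L\<close> unfolding adjoin_multiples_def by blast
      qed
      ultimately have "\<forall>x\<in>insert e E. \<exists>r\<in>carrier R - p.
          r \<odot>\<^bsub>M\<^esub> x \<in> adjoin_multiples (saturation p L) (carrier R) v"
        by simp
      with \<open>prime_submodule p (saturation p L)\<close> \<open>N' \<subseteq> saturation p L\<close> N'(2) False
      show ?thesis by blast
    next
      case True
      then obtain t u r where t: "t \<in> carrier R - p" and u: "u \<in> N'" and r: "r \<in> carrier R"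
        and eq: "t \<odot>\<^bsub>M\<^esub> v = u \<oplus>\<^bsub>M\<^esub> r \<odot>\<^bsub>M\<^esub> e"
        by (auto simp: saturation_def L_def adjoin_multiples_def)
      have uc: "u \<in> carrier M" using u cl(1) by auto
      \<comment> \<open>otherwise \<open>r e\<close>, and so \<open>t v\<close>, would lie in \<open>N'\<close>\<close>
      have "r \<notin> p"
      proof
        assume "r \<in> p"
        then have "t \<odot>\<^bsub>M\<^esub> v \<in> N'"
          using N' e u cl(5) unfolding eq prime_submodule_def by blast
        then show False using N' t v unfolding prime_submodule_def by blast
      qed
      moreover have "r \<odot>\<^bsub>M\<^esub> e = \<ominus>\<^bsub>M\<^esub> u \<oplus>\<^bsub>M\<^esub> t \<odot>\<^bsub>M\<^esub> v"
        unfolding eq using uc r e by (simp add: M.r_neg1)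
      then have "r \<odot>\<^bsub>M\<^esub> e \<in> adjoin_multiples N' (carrier R) v"
        using cl(3) [OF u] t unfolding adjoin_multiples_def by blast
      ultimately show ?thesis
        using N' E r by (intro exI [of _ N']) auto
    qed
  qed
  then show ?thesis using that by blast
qed

lemma common_multiplier_into_submodule:
  assumes p: "primeideal p R" and L: "submodule L R M"
    and "finite E" "E \<subseteq> carrier M" "\<And>e. e \<in> E \<Longrightarrow> \<exists>r\<in>carrier R - p. r \<odot>\<^bsub>M\<^esub> e \<in> L"
  shows "\<exists>r\<in>carrier R - p. \<forall>e\<in>E. r \<odot>\<^bsub>M\<^esub> e \<in> L"
  using assms(3-)
proof (induction E rule: finite_induct)
  interpret p: primeideal p R by fact
  case empty
  then show ?case using p.one_imp_carrier p.I_notcarr by auto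
next
  interpret p: primeideal p R by fact
  case (insert e E)
  then obtain r s where r: "r \<in> carrier R - p" "\<And>e. e \<in> E \<Longrightarrow> r \<odot>\<^bsub>M\<^esub> e \<in> L"
    and s: "s \<in> carrier R - p" "s \<odot>\<^bsub>M\<^esub> e \<in> L"
    by (metis insert_iff insert_subset)
  have "s \<otimes> r \<in> carrier R - p" using r s p.I_prime by auto
  moreover have "(s \<otimes> r) \<odot>\<^bsub>M\<^esub> x \<in> L" if "x \<in> E" for x
    using that insert.prems r s submoduleE(4) [OF L] by (auto simp: smult_assoc1)
  moreover have "(s \<otimes> r) \<odot>\<^bsub>M\<^esub> e \<in> L"
  proof -
    have "(s \<otimes> r) \<odot>\<^bsub>M\<^esub> e = r \<odot>\<^bsub>M\<^esub> (s \<odot>\<^bsub>M\<^esub> e)"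
      using r s insert.prems by (simp add: R.m_comm flip: smult_assoc1)
    then show ?thesis using r s submoduleE(4) [OF L] by auto
  qed
  ultimately show ?case by blast
qed

text \<open>
  By the hypothesis \<open>line\<close>, \<open>r x\<close> is congruent to a multiple \<open>a v\<close> modulo \<open>N\<close>, and \<open>a\<close> is unique modulo
  \<open>p\<close> because \<open>M/N\<close> is torsion-free over \<open>R/p\<close>. So \<open>L\<close> is the kernel of the linear map from \<open>M\<close> to the field
  \<open>R/m\<close> that sends \<open>x\<close> to the class of \<open>a\<close>. This map is nonzero, since \<open>v\<close> goes to the class of \<open>r\<close>.
\<close>
lemma maximal_submodule_over_maximalideal:
  assumes m: "maximalideal m R" and pm: "p \<subseteq> m"
    and N: "prime_submodule p N" and v: "v \<in> carrier M" "v \<notin> N"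
    and r: "r \<in> carrier R" "r \<notin> m"
    and line: "\<And>x. x \<in> carrier M \<Longrightarrow> r \<odot>\<^bsub>M\<^esub> x \<in> adjoin_multiples N (carrier R) v"
  defines "L \<equiv> {x \<in> carrier M. r \<odot>\<^bsub>M\<^esub> x \<in> adjoin_multiples N m v}"
  shows "maximal_submodule L" "N \<subseteq> L" "v \<notin> L"
proof -
  interpret m: maximalideal m R by fact
  have sub: "submodule N R M" using N by (simp add: prime_submodule_def)
  note cl = submoduleE [OF sub]
  have L: "submodule L R M"
    unfolding L_def by (intro submodule_multiplier_preimage submodule_adjoin_multiples sub m.is_ideal v r)
  show "N \<subseteq> L"
  proof
    fix x assume x: "x \<in> N"
    then have "r \<odot>\<^bsub>M\<^esub> x = r \<odot>\<^bsub>M\<^esub> x \<oplus>\<^bsub>M\<^esub> \<zero> \<odot>\<^bsub>M\<^esub> v" using cl(1) r v by auto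
    then have "r \<odot>\<^bsub>M\<^esub> x \<in> adjoin_multiples N m v"
      using cl(4) [OF r(1) x] m.zero_closed unfolding adjoin_multiples_def by blast
    then show "x \<in> L" using x cl(1) by (auto simp: L_def)
  qed
  show vL: "v \<notin> L"
  proof
    assume "v \<in> L"
    then obtain u a where u: "u \<in> N" and a: "a \<in> m" and eq: "r \<odot>\<^bsub>M\<^esub> v = u \<oplus>\<^bsub>M\<^esub> a \<odot>\<^bsub>M\<^esub> v"
      by (auto simp: L_def adjoin_multiples_def)
    have car: "u \<in> carrier M" "a \<in> carrier R" using u a cl(1) m.a_Hcarr by auto
    have "(r \<oplus> \<ominus> a) \<odot>\<^bsub>M\<^esub> v = (u \<oplus>\<^bsub>M\<^esub> a \<odot>\<^bsub>M\<^esub> v) \<oplus>\<^bsub>M\<^esub> \<ominus>\<^bsub>M\<^esub> (a \<odot>\<^bsub>M\<^esub> v)"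
      using car r v by (simp add: smult_l_distr smult_l_minus eq)
    also have "\<dots> = u"
      using car v by (simp add: M.a_assoc M.r_neg)
    finally have "r \<oplus> \<ominus> a \<in> p"
      using N u v r car unfolding prime_submodule_def by (metis R.a_inv_closed R.add.m_closed)
    then have "(r \<oplus> \<ominus> a) \<oplus> a \<in> m" using pm a by blast
    then show False using r car by (simp add: R.a_assoc R.l_neg)
  qed
  have "J = carrier M" if J: "submodule J R M" and LJ: "L \<subseteq> J" and "J \<noteq> L" for J
  proof
    note Jcl = submoduleE [OF J]
    show "J \<subseteq> carrier M" by fact
    obtain y where y: "y \<in> J" "y \<notin> L" using LJ \<open>J \<noteq> L\<close> by blast
    then have yc: "y \<in> carrier M" using Jcl(1) by blast
    obtain u a where u: "u \<in> N" and a: "a \<in> carrier R" and ry: "r \<odot>\<^bsub>M\<^esub> y = u \<oplus>\<^bsub>M\<^esub> a \<odot>\<^bsub>M\<^esub> v"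
      using line [OF yc] by (auto simp: adjoin_multiples_def)
    have "a \<notin> m" using y yc u ry unfolding L_def adjoin_multiples_def by blast
    then obtain b \<mu> where b: "b \<in> carrier R" and \<mu>: "\<mu> \<in> m" and unit: "\<one> = \<mu> \<oplus> b \<otimes> a"
      using R.maximalideal_inverse [OF m a] by blast
    show "carrier M \<subseteq> J"
    proof
      fix z assume z: "z \<in> carrier M"
      obtain u' c where u': "u' \<in> N" and c: "c \<in> carrier R" and rz: "r \<odot>\<^bsub>M\<^esub> z = u' \<oplus>\<^bsub>M\<^esub> c \<odot>\<^bsub>M\<^esub> v"
        using line [OF z] by (auto simp: adjoin_multiples_def)
      \<comment> \<open>\<open>b\<close> inverts \<open>a\<close> modulo \<open>m\<close>, so subtracting \<open>c b y\<close> cancels the value \<open>c\<close> of the map at \<open>z\<close>\<close>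
      define d where "d = \<ominus> (c \<otimes> b)"
      have car: "u \<in> carrier M" "u' \<in> carrier M" "\<mu> \<in> carrier R" "d \<in> carrier R"
        using u u' cl(1) \<mu> m.a_Hcarr b c by (auto simp: d_def)
      have coeff: "c \<oplus> d \<otimes> a = c \<otimes> \<mu>"
      proof -
        have "c = c \<otimes> (\<mu> \<oplus> b \<otimes> a)" unfolding unit [symmetric] using c by simp
        also have "\<dots> = c \<otimes> \<mu> \<oplus> (c \<otimes> b) \<otimes> a"
          using c car a b by (simp add: R.r_distr R.m_assoc)
        finally have "c \<oplus> d \<otimes> a = (c \<otimes> \<mu> \<oplus> (c \<otimes> b) \<otimes> a) \<oplus> d \<otimes> a" by simp
        then show ?thesis
          using c car a b by (simp add: d_def R.l_minus R.a_assoc R.r_neg)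
      qed
      have "r \<odot>\<^bsub>M\<^esub> (z \<oplus>\<^bsub>M\<^esub> d \<odot>\<^bsub>M\<^esub> y) = r \<odot>\<^bsub>M\<^esub> z \<oplus>\<^bsub>M\<^esub> d \<odot>\<^bsub>M\<^esub> (r \<odot>\<^bsub>M\<^esub> y)"
        using r z yc car by (simp add: smult_r_distr R.m_comm flip: smult_assoc1)
      also have "\<dots> = (u' \<oplus>\<^bsub>M\<^esub> c \<odot>\<^bsub>M\<^esub> v) \<oplus>\<^bsub>M\<^esub> (d \<odot>\<^bsub>M\<^esub> u \<oplus>\<^bsub>M\<^esub> (d \<otimes> a) \<odot>\<^bsub>M\<^esub> v)"
        using car v a by (simp add: ry rz smult_r_distr smult_assoc1)
      also have "\<dots> = (u' \<oplus>\<^bsub>M\<^esub> d \<odot>\<^bsub>M\<^esub> u) \<oplus>\<^bsub>M\<^esub> (c \<oplus> d \<otimes> a) \<odot>\<^bsub>M\<^esub> v"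
        using car v a c by (simp add: smult_l_distr M.a_ac)
      finally have "r \<odot>\<^bsub>M\<^esub> (z \<oplus>\<^bsub>M\<^esub> d \<odot>\<^bsub>M\<^esub> y) = (u' \<oplus>\<^bsub>M\<^esub> d \<odot>\<^bsub>M\<^esub> u) \<oplus>\<^bsub>M\<^esub> (c \<otimes> \<mu>) \<odot>\<^bsub>M\<^esub> v"
        by (simp only: coeff)
      moreover have "u' \<oplus>\<^bsub>M\<^esub> d \<odot>\<^bsub>M\<^esub> u \<in> N" using u u' car cl(4,5) by blast
      moreover have "c \<otimes> \<mu> \<in> m" using c \<mu> m.I_l_closed by blast
      ultimately have "z \<oplus>\<^bsub>M\<^esub> d \<odot>\<^bsub>M\<^esub> y \<in> L"
        using z yc car unfolding L_def adjoin_multiples_def by blast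
      then have "d \<odot>\<^bsub>M\<^esub> y \<oplus>\<^bsub>M\<^esub> z \<in> J"
        using LJ z yc car by (auto simp: M.a_comm)
      then show "z \<in> J"
        using submodule_diff [OF J _ Jcl(4)] y(1) z car by blast
    qed
  qed
  then show "maximal_submodule L"
    using L vL v unfolding maximal_submodule_def by blast
qed

text \<open>
  The Jacobson property is needed for the one denominator \<open>r\<close> that serves all generators: some maximal
  ideal over \<open>p\<close> has to avoid it. Finiteness of \<open>E\<close> is what allows a common denominator.
\<close>
lemma prime_submodule_separated_by_maximal_submodule:
  assumes "jacobson_ring R"
    and p: "primeideal p R" and N: "prime_submodule p N" and v: "v \<in> carrier M" "v \<notin> N"
    and E: "finite E" "E \<subseteq> carrier M" "\<And>Q. submodule Q R M \<Longrightarrow> E \<subseteq> Q \<Longrightarrow> Q = carrier M"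
  obtains L where "maximal_submodule L" "N \<subseteq> L" "v \<notin> L"
proof -
  obtain N' where N': "prime_submodule p N'" "N \<subseteq> N'" "v \<notin> N'"
    and gen: "\<And>e. e \<in> E \<Longrightarrow> \<exists>r\<in>carrier R - p. r \<odot>\<^bsub>M\<^esub> e \<in> adjoin_multiples N' (carrier R) v"
    using prime_submodule_enlarge_rank_one [OF p N v E(1,2)] by blast
  have line: "submodule (adjoin_multiples N' (carrier R) v) R M"
    using N' v by (intro submodule_adjoin_multiples R.oneideal) (auto simp: prime_submodule_def)
  obtain r where r: "r \<in> carrier R" "r \<notin> p"
    and rE: "\<And>e. e \<in> E \<Longrightarrow> r \<odot>\<^bsub>M\<^esub> e \<in> adjoin_multiples N' (carrier R) v"
    using common_multiplier_into_submodule [OF p line E(1,2) gen] by blast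
  have "{x \<in> carrier M. r \<odot>\<^bsub>M\<^esub> x \<in> adjoin_multiples N' (carrier R) v} = carrier M"
    using rE E(2) by (intro E(3) submodule_multiplier_preimage line r) auto
  then have all: "r \<odot>\<^bsub>M\<^esub> x \<in> adjoin_multiples N' (carrier R) v" if "x \<in> carrier M" for x
    using that by blast
  obtain F where F: "\<And>m. m \<in> F \<Longrightarrow> maximalideal m R" "p = carrier R \<inter> \<Inter>F"
    using jacobson_ring.primeideal_eq_Inter_maximal [OF assms(1) p] by blast
  then obtain m where m: "maximalideal m R" "p \<subseteq> m" "r \<notin> m" using r by blast
  from maximal_submodule_over_maximalideal [OF m(1,2) N'(1) v(1) N'(3) r(1) m(3) all] N'(2) that
  show ?thesis by blast
qed

end

section \<open>Submodules of the free module of row vectors\<close>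

text \<open>
  The free module \<open>R\<^sup>n\<close>. As in the matrix ring, vectors only serve as containers of entries, so that the rows
  of a matrix are elements; the arithmetic is that of \<open>R\<close>.
\<close>
definition row_module :: "('a, 'b) ring_scheme \<Rightarrow> nat \<Rightarrow> ('a, 'a vec) module" where
  "row_module R n =
    \<lparr>carrier = {v \<in> carrier_vec n. \<forall>i<n. v $ i \<in> carrier R},
     mult = (\<lambda>u v. vec n (\<lambda>i. u $ i \<otimes>\<^bsub>R\<^esub> v $ i)),
     one = vec n (\<lambda>_. \<one>\<^bsub>R\<^esub>),
     zero = vec n (\<lambda>_. \<zero>\<^bsub>R\<^esub>),
     add = (\<lambda>u v. vec n (\<lambda>i. u $ i \<oplus>\<^bsub>R\<^esub> v $ i)),
     smult = (\<lambda>a v. vec n (\<lambda>i. a \<otimes>\<^bsub>R\<^esub> v $ i))\<rparr>"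

lemma row_module_carrier_iff:
  "v \<in> carrier (row_module R n) \<longleftrightarrow> dim_vec v = n \<and> (\<forall>i<n. v $ i \<in> carrier R)"
  unfolding carrier_dim_vec [symmetric] by (simp add: row_module_def)

lemma row_module_simps:
  "\<zero>\<^bsub>row_module R n\<^esub> = vec n (\<lambda>_. \<zero>\<^bsub>R\<^esub>)"
  "u \<oplus>\<^bsub>row_module R n\<^esub> v = vec n (\<lambda>i. u $ i \<oplus>\<^bsub>R\<^esub> v $ i)"
  "a \<odot>\<^bsub>row_module R n\<^esub> v = vec n (\<lambda>i. a \<otimes>\<^bsub>R\<^esub> v $ i)"
  by (simp_all add: row_module_def)

lemma module_row_module:
  assumes "cring R"
  shows "module R (row_module R n)"
proof -
  interpret cring R by fact
  show ?thesis
  proof (rule moduleI [OF assms])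
    show "abelian_group (row_module R n)"
    proof (rule abelian_groupI)
      fix v assume v: "v \<in> carrier (row_module R n)"
      show "\<exists>u\<in>carrier (row_module R n). u \<oplus>\<^bsub>row_module R n\<^esub> v = \<zero>\<^bsub>row_module R n\<^esub>"
        using v by (intro bexI [of _ "vec n (\<lambda>i. \<ominus>\<^bsub>R\<^esub> (v $ i))"])
          (auto simp: row_module_carrier_iff row_module_simps l_neg)
    qed (auto simp: row_module_carrier_iff row_module_simps a_ac)
  qed (auto simp: row_module_carrier_iff row_module_simps l_distr r_distr m_assoc)
qed

locale free_row_module = cring R for R (structure) + fixes n :: nat
begin

abbreviation M where "M \<equiv> row_module R n"

sublocale M: module R M
  by (intro module_row_module cring_axioms)

abbreviation unit_row :: "nat \<Rightarrow> 'a vec" where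
  "unit_row j \<equiv> vec n (\<lambda>i. if i = j then \<one> else \<zero>)"

text \<open>
  Membership is asked of the products \<open>a k \<odot> b k\<close> because it can have two reasons: the \<open>b k\<close> are rows in \<open>N\<close>,
  or the \<open>a k\<close> are entries in \<open>(N : M)\<close>.
\<close>
lemma submodule_combination:
  fixes m :: nat
  assumes N: "submodule N R M"
    and "\<And>k. k < m \<Longrightarrow> a k \<in> carrier R" "\<And>k. k < m \<Longrightarrow> b k \<in> carrier M"
    and "\<And>k. k < m \<Longrightarrow> a k \<odot>\<^bsub>M\<^esub> b k \<in> N"
  shows "vec n (\<lambda>j. \<Oplus>k\<in>{..<m}. a k \<otimes> b k $ j) \<in> N"
  using assms(2-)
proof (induction m)
  case 0
  then show ?case using M.submodule_zero [OF N] by (simp add: row_module_simps)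
next
  case (Suc m)
  have "vec n (\<lambda>j. \<Oplus>k\<in>{..<m}. a k \<otimes> b k $ j) \<in> N" using Suc by simp
  with Suc.prems(3) [of m]
  have "a m \<odot>\<^bsub>M\<^esub> b m \<oplus>\<^bsub>M\<^esub> vec n (\<lambda>j. \<Oplus>k\<in>{..<m}. a k \<otimes> b k $ j) \<in> N"
    using M.submoduleE(5) [OF N] by blast
  also have "a m \<odot>\<^bsub>M\<^esub> b m \<oplus>\<^bsub>M\<^esub> vec n (\<lambda>j. \<Oplus>k\<in>{..<m}. a k \<otimes> b k $ j) =
      vec n (\<lambda>j. \<Oplus>k\<in>{..<Suc m}. a k \<otimes> b k $ j)"
    using Suc.prems(1,2)
    by (auto simp: lessThan_Suc row_module_carrier_iff row_module_simps intro!: finsum_insert [symmetric])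
  finally show ?case .
qed

lemma row_expansion:
  assumes "v \<in> carrier M"
  shows "v = vec n (\<lambda>j. \<Oplus>k\<in>{..<n}. v $ k \<otimes> unit_row k $ j)"
proof (rule eq_vecI)
  fix j assume "j < dim_vec (vec n (\<lambda>j. \<Oplus>k\<in>{..<n}. v $ k \<otimes> unit_row k $ j))"
  then have j: "j < n" by simp
  have "(\<Oplus>k\<in>{..<n}. v $ k \<otimes> unit_row k $ j) = (\<Oplus>k\<in>{..<n}. if j = k then v $ k else \<zero>)"
    using assms j by (intro finsum_cong') (auto simp: row_module_carrier_iff)
  also have "\<dots> = v $ j"
    using assms j by (intro finsum_singleton) (auto simp: row_module_carrier_iff)
  finally show "v $ j = vec n (\<lambda>j. \<Oplus>k\<in>{..<n}. v $ k \<otimes> unit_row k $ j) $ j"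
    using j by simp
qed (use assms in \<open>simp add: row_module_carrier_iff\<close>)

lemma submodule_eq_carrier_if_unit_rows:
  assumes Q: "submodule Q R M" and units: "unit_row ` {..<n} \<subseteq> Q"
  shows "Q = carrier M"
proof
  show "Q \<subseteq> carrier M" using M.submoduleE(1) [OF Q] .
  show "carrier M \<subseteq> Q"
  proof
    fix v assume v: "v \<in> carrier M"
    have "vec n (\<lambda>j. \<Oplus>k\<in>{..<n}. v $ k \<otimes> unit_row k $ j) \<in> Q"
    proof (rule submodule_combination [OF Q])
      fix k assume "k < n"
      then show "v $ k \<in> carrier R" using v by (simp add: row_module_carrier_iff)
      moreover have "unit_row k \<in> Q" using units \<open>k < n\<close> by blast
      ultimately show "v $ k \<odot>\<^bsub>M\<^esub> unit_row k \<in> Q" by (rule M.submoduleE(4) [OF Q])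
    qed (simp add: row_module_carrier_iff)
    then show "v \<in> Q" using row_expansion [OF v] by simp
  qed
qed

text \<open>
  The products \<open>A X A\<close>, where \<open>A\<close> has first row \<open>v\<close> and no other nonzero row, again have only a first
  row, and it runs through the multiples of \<open>v\<close> by the elements of the ideal that the entries of \<open>v\<close>
  generate.
\<close>
definition semiprime_submodule :: "'a vec set \<Rightarrow> bool" where
  "semiprime_submodule N \<longleftrightarrow> submodule N R M \<and>
     (\<forall>v\<in>carrier M. (\<forall>k<n. v $ k \<odot>\<^bsub>M\<^esub> v \<in> N) \<longrightarrow> v \<in> N)"

lemma semiprime_submoduleD:
  assumes "semiprime_submodule N" "v \<in> carrier M" "\<And>k. k < n \<Longrightarrow> v $ k \<odot>\<^bsub>M\<^esub> v \<in> N"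
  shows "v \<in> N"
  using assms unfolding semiprime_submodule_def by blast

text \<open>This is \<open>N + p R\<^sup>n\<close>, as the rows with all entries in \<open>p\<close> make up \<open>p R\<^sup>n\<close>.\<close>
definition congruent_rows :: "'a set \<Rightarrow> 'a vec set \<Rightarrow> 'a vec set" where
  "congruent_rows p N = {x \<in> carrier M. \<exists>u\<in>N. \<exists>q\<in>carrier M. (\<forall>j<n. q $ j \<in> p) \<and> x = u \<oplus>\<^bsub>M\<^esub> q}"

lemma submodule_congruent_rows:
  assumes "ideal p R" and N: "submodule N R M"
  shows "submodule (congruent_rows p N) R M"
proof -
  interpret p: ideal p R by fact
  note cl = M.submoduleE [OF N]
  have mem: "x \<in> congruent_rows p N"
    if "x = u \<oplus>\<^bsub>M\<^esub> q" "u \<in> N" "q \<in> carrier M" "\<And>j. j < n \<Longrightarrow> q $ j \<in> p" for x u q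
    using that cl(1) unfolding congruent_rows_def by blast
  show ?thesis
  proof (rule M.submoduleI')
    show "congruent_rows p N \<subseteq> carrier M" by (auto simp: congruent_rows_def)
    show "\<zero>\<^bsub>M\<^esub> \<in> congruent_rows p N"
      by (rule mem [of _ "\<zero>\<^bsub>M\<^esub>" "\<zero>\<^bsub>M\<^esub>"])
        (use M.submodule_zero [OF N] M.M.zero_closed in \<open>auto simp: row_module_simps\<close>)
  next
    fix x y assume "x \<in> congruent_rows p N" "y \<in> congruent_rows p N"
    then obtain u q u' q' where *: "u \<in> N" "q \<in> carrier M" "\<forall>j<n. q $ j \<in> p" "x = u \<oplus>\<^bsub>M\<^esub> q"
      "u' \<in> N" "q' \<in> carrier M" "\<forall>j<n. q' $ j \<in> p" "y = u' \<oplus>\<^bsub>M\<^esub> q'"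
      unfolding congruent_rows_def by blast
    have "u \<in> carrier M" "u' \<in> carrier M" using * cl(1) by auto
    then have "x \<oplus>\<^bsub>M\<^esub> y = (u \<oplus>\<^bsub>M\<^esub> u') \<oplus>\<^bsub>M\<^esub> (q \<oplus>\<^bsub>M\<^esub> q')"
      using * by (simp add: M.M.a_ac)
    then show "x \<oplus>\<^bsub>M\<^esub> y \<in> congruent_rows p N"
      by (rule mem) (use * cl(5) M.M.add.m_closed [OF *(2,6)] in \<open>auto simp: row_module_simps(2)\<close>)
  next
    fix a x assume a: "a \<in> carrier R" and "x \<in> congruent_rows p N"
    then obtain u q where *: "u \<in> N" "q \<in> carrier M" "\<forall>j<n. q $ j \<in> p" "x = u \<oplus>\<^bsub>M\<^esub> q"
      unfolding congruent_rows_def by blast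
    have "u \<in> carrier M" using * cl(1) by auto
    then have "a \<odot>\<^bsub>M\<^esub> x = a \<odot>\<^bsub>M\<^esub> u \<oplus>\<^bsub>M\<^esub> a \<odot>\<^bsub>M\<^esub> q"
      using * a M.smult_r_distr by blast
    then show "a \<odot>\<^bsub>M\<^esub> x \<in> congruent_rows p N"
      by (rule mem) (use * a cl(4) p.I_l_closed M.smult_closed [OF a *(2)] in \<open>auto simp: row_module_simps(3)\<close>)
  qed
qed

text \<open>
  Semiprimeness of \<open>N\<close> is used twice: it makes \<open>J = (N : v)\<close> a radical ideal, and it absorbs the error
  term \<open>q\<close> of a relation \<open>s v = u + q\<close> into \<open>N\<close>. The prime \<open>p\<close> is taken minimal over \<open>J\<close> so that finitely
  many elements of \<open>p\<close>, here the entries of \<open>q\<close>, can be multiplied into \<open>J\<close> by a single element outside \<open>p\<close>.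
\<close>
lemma semiprime_submodule_separated_by_prime_submodule:
  assumes N: "semiprime_submodule N" and v: "v \<in> carrier M" "v \<notin> N"
  obtains p P where "primeideal p R" "M.prime_submodule p P" "N \<subseteq> P" "v \<notin> P"
proof -
  have sub: "submodule N R M" using N by (simp add: semiprime_submodule_def)
  note cl = M.submoduleE [OF sub]
  have entry: "x $ j \<in> carrier R" if "x \<in> carrier M" "j < n" for x j
    using that by (simp add: row_module_carrier_iff)
  define J where "J = {a \<in> carrier R. a \<odot>\<^bsub>M\<^esub> v \<in> N}"
  have idealJ: "ideal J R"
    using M.ideal_transporter [OF sub, of "{v}"] v by (simp add: J_def)
  have "\<one> \<notin> J" using v M.smult_one [OF v(1)] by (simp add: J_def)
  then have "J \<noteq> carrier R" by blast
  moreover have "a \<in> J" if a: "a \<in> carrier R" "a \<otimes> a \<in> J" for a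
  proof -
    have "a \<odot>\<^bsub>M\<^esub> v \<in> N"
    proof (rule semiprime_submoduleD [OF N])
      show "a \<odot>\<^bsub>M\<^esub> v \<in> carrier M" using a v M.smult_closed by blast
      fix k assume k: "k < n"
      have "(a \<odot>\<^bsub>M\<^esub> v) $ k \<odot>\<^bsub>M\<^esub> (a \<odot>\<^bsub>M\<^esub> v) = v $ k \<odot>\<^bsub>M\<^esub> ((a \<otimes> a) \<odot>\<^bsub>M\<^esub> v)"
        using a v k by (auto simp: row_module_carrier_iff row_module_simps m_ac)
      also have "\<dots> \<in> N" using that entry [OF v(1) k] cl(4) unfolding J_def by blast
      finally show "(a \<odot>\<^bsub>M\<^esub> v) $ k \<odot>\<^bsub>M\<^esub> (a \<odot>\<^bsub>M\<^esub> v) \<in> N" .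
    qed
    then show ?thesis using a by (simp add: J_def)
  qed
  ultimately obtain p where p: "primeideal p R" "J \<subseteq> p"
    and kill: "\<And>a. a \<in> p \<Longrightarrow> \<exists>t\<in>carrier R - p. t \<otimes> a \<in> J"
    using radical_ideal_minimal_prime [OF idealJ] by blast
  interpret p: primeideal p R by fact
  have one: "\<one> \<in> carrier R - p" using p.one_imp_carrier p.I_notcarr by auto
  define P where "P = M.saturation p (congruent_rows p N)"
  have C: "submodule (congruent_rows p N) R M"
    by (intro submodule_congruent_rows p.is_ideal sub)
  have "a \<odot>\<^bsub>M\<^esub> x \<in> congruent_rows p N" if "a \<in> p" "x \<in> carrier M" for a x
  proof -
    have ac: "a \<in> carrier R" using that p.a_Hcarr by blast
    have "a \<odot>\<^bsub>M\<^esub> x \<in> carrier M" using ac that M.smult_closed by blast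
    moreover from this have "a \<odot>\<^bsub>M\<^esub> x = \<zero>\<^bsub>M\<^esub> \<oplus>\<^bsub>M\<^esub> a \<odot>\<^bsub>M\<^esub> x" using M.M.l_zero by metis
    moreover have "\<forall>j<n. (a \<odot>\<^bsub>M\<^esub> x) $ j \<in> p" using that entry p.I_r_closed by (simp add: row_module_simps)
    ultimately show ?thesis using M.submodule_zero [OF sub] unfolding congruent_rows_def by blast
  qed
  then have "M.prime_submodule p P"
    unfolding P_def by (intro M.prime_submodule_saturation p C)
  moreover have "N \<subseteq> P"
  proof
    fix x assume x: "x \<in> N"
    then have xc: "x \<in> carrier M" using cl(1) by blast
    then have "x = x \<oplus>\<^bsub>M\<^esub> \<zero>\<^bsub>M\<^esub>" using M.M.r_zero by metis
    moreover have "\<forall>j<n. \<zero>\<^bsub>M\<^esub> $ j \<in> p" by (simp add: row_module_simps)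
    ultimately have "x \<in> congruent_rows p N"
      using x xc M.M.zero_closed unfolding congruent_rows_def by blast
    then show "x \<in> P"
      unfolding P_def using one xc M.smult_one by (intro M.saturationI [of \<one>]) metis+
  qed
  moreover have "v \<notin> P"
  proof
    assume "v \<in> P"
    then obtain s u q where s: "s \<in> carrier R - p" and u: "u \<in> N"
      and q: "q \<in> carrier M" "\<And>j. j < n \<Longrightarrow> q $ j \<in> p" and sv: "s \<odot>\<^bsub>M\<^esub> v = u \<oplus>\<^bsub>M\<^esub> q"
      unfolding P_def M.saturation_def congruent_rows_def by blast
    obtain t where t: "t \<in> carrier R - p" and tq: "\<And>j. j < n \<Longrightarrow> t \<otimes> q $ j \<in> J"
      using common_multiplier_into_ideal [OF p(1) idealJ, of n "($) q"] q(2) kill entry [OF q(1)] by blast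
    have uc: "u \<in> carrier M" using u cl(1) by blast
    have tc: "t \<in> carrier R" "s \<in> carrier R" using s t by auto
    have eq: "(t \<otimes> s) \<odot>\<^bsub>M\<^esub> v = t \<odot>\<^bsub>M\<^esub> u \<oplus>\<^bsub>M\<^esub> t \<odot>\<^bsub>M\<^esub> q"
      using M.smult_assoc1 [OF tc v(1)] M.smult_r_distr [OF tc(1) uc q(1)] sv by metis
    have tqc: "t \<odot>\<^bsub>M\<^esub> q \<in> carrier M" and tuN: "t \<odot>\<^bsub>M\<^esub> u \<in> N"
      using tc q u cl(4) M.smult_closed by blast+
    have "t \<odot>\<^bsub>M\<^esub> q \<in> N"
    proof (rule semiprime_submoduleD [OF N tqc])
      fix k assume k: "k < n"
      define c where "c = t \<otimes> q $ k"
      have c: "c \<in> J" "c \<in> carrier R" using tq k by (auto simp: c_def J_def)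
      \<comment> \<open>an entry \<open>c\<close> of \<open>t q\<close> multiplies both \<open>v\<close> and \<open>u\<close> into \<open>N\<close>, hence also \<open>t q = t s v - t u\<close>\<close>
      have "c \<odot>\<^bsub>M\<^esub> (t \<odot>\<^bsub>M\<^esub> u) \<oplus>\<^bsub>M\<^esub> c \<odot>\<^bsub>M\<^esub> (t \<odot>\<^bsub>M\<^esub> q) = c \<odot>\<^bsub>M\<^esub> ((t \<otimes> s) \<odot>\<^bsub>M\<^esub> v)"
        using M.smult_r_distr [OF c(2) _ tqc] tuN cl(1) eq by (metis subsetD)
      also have "\<dots> = (t \<otimes> s) \<odot>\<^bsub>M\<^esub> (c \<odot>\<^bsub>M\<^esub> v)"
        using M.smult_assoc1 v c tc m_comm by (metis m_closed)
      also have "\<dots> \<in> N" using c tc cl(4) unfolding J_def by blast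
      finally have "c \<odot>\<^bsub>M\<^esub> (t \<odot>\<^bsub>M\<^esub> q) \<in> N"
        by (rule M.submodule_diff [OF sub]) (use c tqc tuN cl(4) M.smult_closed in blast)+
      then show "(t \<odot>\<^bsub>M\<^esub> q) $ k \<odot>\<^bsub>M\<^esub> (t \<odot>\<^bsub>M\<^esub> q) \<in> N"
        using k by (simp add: c_def row_module_simps(3))
    qed
    then have "t \<otimes> s \<in> J"
      using eq tuN cl(5) tc unfolding J_def by auto
    then show False using p(2) p.I_prime s t by blast
  qed
  ultimately show ?thesis using that p by blast
qed

end

section \<open>Left ideals of the matrix ring and their rows\<close>

context free_row_module
begin

abbreviation S where "S \<equiv> matrix_ring R n"

lemma ring_S: "ring S"
  by (intro ring_matrix_ring ring_axioms)

sublocale S: ring S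
  by (rule ring_S)

lemma matrix_carrier_iff:
  "A \<in> carrier S \<longleftrightarrow> dim_row A = n \<and> dim_col A = n \<and> (\<forall>i<n. \<forall>j<n. A $$ (i, j) \<in> carrier R)"
  by (auto simp: matrix_ring_def)

lemma matrix_mult: "A \<otimes>\<^bsub>S\<^esub> B = mat n n (\<lambda>(i, j). \<Oplus>k\<in>{..<n}. A $$ (i, k) \<otimes> B $$ (k, j))"
  by (simp add: matrix_ring_def)

lemma matrix_add: "A \<oplus>\<^bsub>S\<^esub> B = mat n n (\<lambda>(i, j). A $$ (i, j) \<oplus> B $$ (i, j))"
  by (simp add: matrix_ring_def)

lemma matrix_zero: "\<zero>\<^bsub>S\<^esub> = mat n n (\<lambda>(i, j). \<zero>)"
  by (simp add: matrix_ring_def)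

lemma row_in_carrier: "A \<in> carrier S \<Longrightarrow> i < n \<Longrightarrow> row A i \<in> carrier M"
  by (simp add: matrix_carrier_iff row_module_carrier_iff)

lemma row_add:
  "A \<in> carrier S \<Longrightarrow> B \<in> carrier S \<Longrightarrow> i < n \<Longrightarrow> row (A \<oplus>\<^bsub>S\<^esub> B) i = row A i \<oplus>\<^bsub>M\<^esub> row B i"
  by (rule eq_vecI) (simp_all add: matrix_add matrix_carrier_iff row_module_simps)

lemma row_zero: "i < n \<Longrightarrow> row \<zero>\<^bsub>S\<^esub> i = \<zero>\<^bsub>M\<^esub>"
  by (rule eq_vecI) (simp_all add: matrix_zero row_module_simps)

lemma row_mult:
  assumes "A \<in> carrier S" "B \<in> carrier S" "i < n"
  shows "row (A \<otimes>\<^bsub>S\<^esub> B) i = vec n (\<lambda>j. \<Oplus>k\<in>{..<n}. A $$ (i, k) \<otimes> row B k $ j)"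
proof (rule eq_vecI)
  fix j assume "j < dim_vec (vec n (\<lambda>j. \<Oplus>k\<in>{..<n}. A $$ (i, k) \<otimes> row B k $ j))"
  then have "j < n" by simp
  moreover from this have "(\<Oplus>k\<in>{..<n}. A $$ (i, k) \<otimes> B $$ (k, j)) =
      (\<Oplus>k\<in>{..<n}. A $$ (i, k) \<otimes> row B k $ j)"
    using assms by (intro finsum_cong') (auto simp: matrix_carrier_iff)
  ultimately show "row (A \<otimes>\<^bsub>S\<^esub> B) i $ j =
      vec n (\<lambda>j. \<Oplus>k\<in>{..<n}. A $$ (i, k) \<otimes> row B k $ j) $ j"
    using assms by (simp add: matrix_mult)
qed (simp add: matrix_mult)

definition matrix_unit :: "nat \<Rightarrow> nat \<Rightarrow> 'a mat" where
  "matrix_unit a b = mat n n (\<lambda>(i, j). if i = a \<and> j = b then \<one> else \<zero>)"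

lemma matrix_unit_carrier: "matrix_unit a b \<in> carrier S"
  by (auto simp: matrix_carrier_iff matrix_unit_def)

lemma matrix_unit_mult:
  assumes "A \<in> carrier S" "b < n"
  shows "matrix_unit a b \<otimes>\<^bsub>S\<^esub> A = mat n n (\<lambda>(i, j). if i = a then A $$ (b, j) else \<zero>)"
proof (rule eq_matI)
  fix i j assume "i < dim_row (mat n n (\<lambda>(i, j). if i = a then A $$ (b, j) else \<zero>))"
    "j < dim_col (mat n n (\<lambda>(i, j). if i = a then A $$ (b, j) else \<zero>))"
  then have ij: "i < n" "j < n" by auto
  have "(\<Oplus>k\<in>{..<n}. matrix_unit a b $$ (i, k) \<otimes> A $$ (k, j)) =
      (\<Oplus>k\<in>{..<n}. if b = k then (if i = a then A $$ (k, j) else \<zero>) else \<zero>)"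
    using assms ij by (intro finsum_cong') (auto simp: matrix_carrier_iff matrix_unit_def)
  also have "\<dots> = (if i = a then A $$ (b, j) else \<zero>)"
    using assms ij by (intro finsum_singleton) (auto simp: matrix_carrier_iff)
  finally show "(matrix_unit a b \<otimes>\<^bsub>S\<^esub> A) $$ (i, j) =
      mat n n (\<lambda>(i, j). if i = a then A $$ (b, j) else \<zero>) $$ (i, j)"
    using ij by (simp add: matrix_mult)
qed (simp_all add: matrix_mult)

definition matrices_with_rows_in :: "'a vec set \<Rightarrow> 'a mat set" where
  "matrices_with_rows_in N = {A \<in> carrier S. \<forall>i<n. row A i \<in> N}"

definition single_row :: "'a vec \<Rightarrow> 'a mat" where
  "single_row v = mat n n (\<lambda>(i, j). if i = 0 then v $ j else \<zero>)"

text \<open>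
  Every row of a matrix in a left ideal can be moved to the first place and isolated there by a matrix unit,
  so these first rows are all the rows that occur in \<open>I\<close>.
\<close>
definition row_submodule :: "'a mat set \<Rightarrow> 'a vec set" where
  "row_submodule I = {v \<in> carrier M. single_row v \<in> I}"

lemma single_row_carrier: "v \<in> carrier M \<Longrightarrow> single_row v \<in> carrier S"
  by (auto simp: single_row_def matrix_carrier_iff row_module_carrier_iff)

lemma row_single_row:
  "v \<in> carrier M \<Longrightarrow> i < n \<Longrightarrow> row (single_row v) i = (if i = 0 then v else \<zero>\<^bsub>M\<^esub>)"
  by (rule eq_vecI) (auto simp: single_row_def row_module_carrier_iff row_module_simps)

lemma single_row_add:
  "u \<in> carrier M \<Longrightarrow> v \<in> carrier M \<Longrightarrow> single_row (u \<oplus>\<^bsub>M\<^esub> v) = single_row u \<oplus>\<^bsub>S\<^esub> single_row v"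
  by (rule eq_matI) (auto simp: single_row_def matrix_add row_module_simps row_module_carrier_iff)

lemma mult_single_row:
  assumes A: "A \<in> carrier S" and v: "v \<in> carrier M" and n: "n > 0"
  shows "A \<otimes>\<^bsub>S\<^esub> single_row v = mat n n (\<lambda>(i, j). A $$ (i, 0) \<otimes> v $ j)"
proof (rule eq_matI)
  fix i j assume "i < dim_row (mat n n (\<lambda>(i, j). A $$ (i, 0) \<otimes> v $ j))"
    "j < dim_col (mat n n (\<lambda>(i, j). A $$ (i, 0) \<otimes> v $ j))"
  then have ij: "i < n" "j < n" by auto
  have "(\<Oplus>k\<in>{..<n}. A $$ (i, k) \<otimes> single_row v $$ (k, j)) =
      (\<Oplus>k\<in>{..<n}. if 0 = k then A $$ (i, k) \<otimes> v $ j else \<zero>)"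
    using A v ij
    by (intro finsum_cong') (auto simp: matrix_carrier_iff single_row_def row_module_carrier_iff)
  also have "\<dots> = A $$ (i, 0) \<otimes> v $ j"
    using A v ij n by (intro finsum_singleton) (auto simp: matrix_carrier_iff row_module_carrier_iff)
  finally show "(A \<otimes>\<^bsub>S\<^esub> single_row v) $$ (i, j) = mat n n (\<lambda>(i, j). A $$ (i, 0) \<otimes> v $ j) $$ (i, j)"
    using ij by (simp add: matrix_mult)
qed (simp_all add: matrix_mult)

text \<open>
  Scalar multiplication on rows is a left multiplication by a matrix, here by \<open>a\<close> times the matrix unit in
  the top left corner. This is why left ideals yield submodules.
\<close>
lemma scaled_single_row:
  assumes n: "n > 0" and a: "a \<in> carrier R" and v: "v \<in> carrier M"
  shows "single_row (a \<odot>\<^bsub>M\<^esub> unit_row 0) \<otimes>\<^bsub>S\<^esub> single_row v = single_row (a \<odot>\<^bsub>M\<^esub> v)"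
proof -
  have "single_row (a \<odot>\<^bsub>M\<^esub> unit_row 0) \<in> carrier S"
    using a by (intro single_row_carrier) (auto simp: row_module_carrier_iff row_module_simps)
  from mult_single_row [OF this v n] show ?thesis
    using a v n by (auto simp: single_row_def row_module_simps row_module_carrier_iff)
qed

lemma submodule_row_submodule:
  assumes n: "n > 0" and "left_ideal I S"
  shows "submodule (row_submodule I) R M"
proof -
  interpret I: left_ideal I S by fact
  show ?thesis
  proof (rule M.submoduleI')
    show "row_submodule I \<subseteq> carrier M" by (auto simp: row_submodule_def)
    have "single_row \<zero>\<^bsub>M\<^esub> = \<zero>\<^bsub>S\<^esub>"
      by (rule eq_matI) (auto simp: single_row_def matrix_zero row_module_simps)
    then show "\<zero>\<^bsub>M\<^esub> \<in> row_submodule I"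
      using I.zero_closed M.M.zero_closed by (simp add: row_submodule_def)
  next
    fix x y assume "x \<in> row_submodule I" "y \<in> row_submodule I"
    then show "x \<oplus>\<^bsub>M\<^esub> y \<in> row_submodule I"
      using I.a_closed by (simp add: row_submodule_def single_row_add)
  next
    fix a x assume a: "a \<in> carrier R" and x: "x \<in> row_submodule I"
    have "single_row (a \<odot>\<^bsub>M\<^esub> unit_row 0) \<in> carrier S"
      using a by (intro single_row_carrier) (auto simp: row_module_carrier_iff row_module_simps)
    with x have "single_row (a \<odot>\<^bsub>M\<^esub> unit_row 0) \<otimes>\<^bsub>S\<^esub> single_row x \<in> I"
      by (intro I.I_l_closed) (simp_all add: row_submodule_def)
    then show "a \<odot>\<^bsub>M\<^esub> x \<in> row_submodule I"
      using x a n by (simp add: row_submodule_def scaled_single_row)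
  qed
qed

text \<open>
  Matrix units from the left pick out a row, and they also reassemble a matrix as the sum of its rows.
\<close>
lemma mem_left_ideal_iff_rows:
  assumes n: "n > 0" and "left_ideal I S" and A: "A \<in> carrier S"
  shows "A \<in> I \<longleftrightarrow> (\<forall>i<n. row A i \<in> row_submodule I)"
proof
  interpret I: left_ideal I S by fact
  show "\<forall>i<n. row A i \<in> row_submodule I" if "A \<in> I"
  proof (intro allI impI)
    fix i assume i: "i < n"
    have "single_row (row A i) = matrix_unit 0 i \<otimes>\<^bsub>S\<^esub> A"
      unfolding matrix_unit_mult [OF A i] using A i
      by (intro eq_matI) (auto simp: single_row_def matrix_carrier_iff)
    also have "\<dots> \<in> I" using that matrix_unit_carrier by (rule I.I_l_closed)
    finally show "row A i \<in> row_submodule I"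
      using row_in_carrier [OF A i] by (simp add: row_submodule_def)
  qed
next
  interpret I: left_ideal I S by fact
  assume rows: "\<forall>i<n. row A i \<in> row_submodule I"
  \<comment> \<open>the first \<open>m\<close> rows of \<open>A\<close>\<close>
  define B where "B m = mat n n (\<lambda>(i, j). if i < m then A $$ (i, j) else \<zero>)" for m :: nat
  have "B m \<in> I" if "m \<le> n" for m
    using that
  proof (induction m)
    case 0
    have "B 0 = \<zero>\<^bsub>S\<^esub>" by (simp add: B_def matrix_zero)
    then show ?case using I.zero_closed by simp
  next
    case (Suc m)
    then have m: "m < n" by simp
    have c: "single_row (row A m) \<in> carrier S"
      using row_in_carrier [OF A m] by (rule single_row_carrier)
    have "B (Suc m) = B m \<oplus>\<^bsub>S\<^esub> matrix_unit m 0 \<otimes>\<^bsub>S\<^esub> single_row (row A m)"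
      unfolding matrix_unit_mult [OF c n] using A m
      by (intro eq_matI) (auto simp: B_def matrix_add single_row_def matrix_carrier_iff less_Suc_eq)
    also have "\<dots> \<in> I"
      using Suc rows m matrix_unit_carrier
      by (intro I.a_closed I.I_l_closed) (auto simp: row_submodule_def)
    finally show ?case .
  qed
  moreover have "B n = A" using A by (intro eq_matI) (auto simp: B_def matrix_carrier_iff)
  ultimately show "A \<in> I" by auto
qed

lemma left_ideal_matrices_with_rows_in:
  assumes N: "submodule N R M"
  shows "left_ideal (matrices_with_rows_in N) S"
proof -
  note cl = M.submoduleE [OF N]
  have mult: "B \<otimes>\<^bsub>S\<^esub> A \<in> matrices_with_rows_in N"
    if A: "A \<in> matrices_with_rows_in N" and B: "B \<in> carrier S" for A B
  proof -
    have Ac: "A \<in> carrier S" and rows: "\<And>i. i < n \<Longrightarrow> row A i \<in> N"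
      using A by (auto simp: matrices_with_rows_in_def)
    have "row (B \<otimes>\<^bsub>S\<^esub> A) i \<in> N" if i: "i < n" for i
      unfolding row_mult [OF B Ac i]
    proof (rule submodule_combination [OF N])
      fix k assume k: "k < n"
      show "B $$ (i, k) \<in> carrier R" using B i k by (simp add: matrix_carrier_iff)
      then show "B $$ (i, k) \<odot>\<^bsub>M\<^esub> row A k \<in> N" using rows [OF k] by (rule cl(4))
      show "row A k \<in> carrier M" using row_in_carrier [OF Ac k] .
    qed
    then show ?thesis using S.m_closed [OF B Ac] by (simp add: matrices_with_rows_in_def)
  qed
  have "subgroup (matrices_with_rows_in N) (add_monoid S)"
  proof (rule S.add.subgroupI)
    show "matrices_with_rows_in N \<subseteq> carrier S" by (auto simp: matrices_with_rows_in_def)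
    have "\<zero>\<^bsub>S\<^esub> \<in> matrices_with_rows_in N"
      using M.submodule_zero [OF N] S.zero_closed by (simp add: matrices_with_rows_in_def row_zero)
    then show "matrices_with_rows_in N \<noteq> {}" by blast
  next
    fix A assume A: "A \<in> matrices_with_rows_in N"
    then have Ac: "A \<in> carrier S" by (simp add: matrices_with_rows_in_def)
    have "\<ominus>\<^bsub>S\<^esub> A = (\<ominus>\<^bsub>S\<^esub> \<one>\<^bsub>S\<^esub>) \<otimes>\<^bsub>S\<^esub> A"
      using S.l_minus [OF S.one_closed Ac] S.l_one [OF Ac] by simp
    also have "\<dots> \<in> matrices_with_rows_in N"
      by (rule mult [OF A S.a_inv_closed [OF S.one_closed]])
    finally show "\<ominus>\<^bsub>S\<^esub> A \<in> matrices_with_rows_in N" .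
  next
    fix A B assume "A \<in> matrices_with_rows_in N" "B \<in> matrices_with_rows_in N"
    then show "A \<oplus>\<^bsub>S\<^esub> B \<in> matrices_with_rows_in N"
      using cl(5) S.a_closed by (simp add: matrices_with_rows_in_def row_add)
  qed
  then show ?thesis
    by (intro left_ideal.intro additive_subgroup.intro left_ideal_axioms.intro ring_S mult)
qed

text \<open>
  Row \<open>i\<close> of \<open>A E B\<close>, with \<open>E\<close> the matrix unit at \<open>(k, l)\<close>, is the entry of \<open>A\<close> at \<open>(i, k)\<close> times row \<open>l\<close> of
  \<open>B\<close>. If some row of \<open>B\<close> is outside \<open>N\<close>, all entries of \<open>A\<close> are therefore in \<open>p\<close>, and they multiply every
  row into \<open>N\<close>.
\<close>
lemma prime_left_ideal_matrices_with_rows_in: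
  assumes N: "M.prime_submodule p N"
  shows "prime_left_ideal (matrices_with_rows_in N) S"
proof (intro prime_left_ideal.intro prime_left_ideal_axioms.intro)
  have sub: "submodule N R M" using N by (simp add: M.prime_submodule_def)
  show "left_ideal (matrices_with_rows_in N) S"
    by (rule left_ideal_matrices_with_rows_in [OF sub])
  fix A B assume A: "A \<in> carrier S" and B: "B \<in> carrier S"
    and AB: "\<And>X. X \<in> carrier S \<Longrightarrow> A \<otimes>\<^bsub>S\<^esub> X \<otimes>\<^bsub>S\<^esub> B \<in> matrices_with_rows_in N"
  show "(\<forall>X\<in>carrier S. A \<otimes>\<^bsub>S\<^esub> X \<in> matrices_with_rows_in N) \<or> B \<in> matrices_with_rows_in N"
  proof (rule disjCI)
    assume "B \<notin> matrices_with_rows_in N"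
    then obtain l where l: "l < n" "row B l \<notin> N" using B by (auto simp: matrices_with_rows_in_def)
    have entry: "A $$ (i, k) \<in> carrier R" if "i < n" "k < n" for i k
      using that A by (simp add: matrix_carrier_iff)
    have "A $$ (i, k) \<in> p" if i: "i < n" and k: "k < n" for i k
    proof -
      have UB: "matrix_unit k l \<otimes>\<^bsub>S\<^esub> B \<in> carrier S"
        using matrix_unit_carrier B by (rule S.m_closed)
      have "row (A \<otimes>\<^bsub>S\<^esub> matrix_unit k l \<otimes>\<^bsub>S\<^esub> B) i \<in> N"
        using AB [OF matrix_unit_carrier] i by (simp add: matrices_with_rows_in_def)
      also have "A \<otimes>\<^bsub>S\<^esub> matrix_unit k l \<otimes>\<^bsub>S\<^esub> B = A \<otimes>\<^bsub>S\<^esub> (matrix_unit k l \<otimes>\<^bsub>S\<^esub> B)"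
        using A matrix_unit_carrier B by (rule S.m_assoc)
      also have "row (A \<otimes>\<^bsub>S\<^esub> (matrix_unit k l \<otimes>\<^bsub>S\<^esub> B)) i = A $$ (i, k) \<odot>\<^bsub>M\<^esub> row B l"
      proof (rule eq_vecI)
        fix j assume "j < dim_vec (A $$ (i, k) \<odot>\<^bsub>M\<^esub> row B l)"
        then have j: "j < n" by (simp add: row_module_simps)
        have "(\<Oplus>m\<in>{..<n}. A $$ (i, m) \<otimes> (matrix_unit k l \<otimes>\<^bsub>S\<^esub> B) $$ (m, j)) =
            (\<Oplus>m\<in>{..<n}. if k = m then A $$ (i, m) \<otimes> B $$ (l, j) else \<zero>)"
          unfolding matrix_unit_mult [OF B l(1)] using A B i j l(1)
          by (intro finsum_cong') (auto simp: matrix_carrier_iff)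
        also have "\<dots> = A $$ (i, k) \<otimes> B $$ (l, j)"
          using A B i j k l(1) by (intro finsum_singleton) (auto simp: matrix_carrier_iff)
        finally show "row (A \<otimes>\<^bsub>S\<^esub> (matrix_unit k l \<otimes>\<^bsub>S\<^esub> B)) i $ j = (A $$ (i, k) \<odot>\<^bsub>M\<^esub> row B l) $ j"
          using i j l(1) B by (simp add: matrix_mult [of A] row_module_simps matrix_carrier_iff)
      qed (simp add: matrix_mult [of A] row_module_simps)
      finally show ?thesis
        using N l row_in_carrier [OF B l(1)] entry [OF i k] unfolding M.prime_submodule_def by blast
    qed
    then have rows: "A $$ (i, k) \<odot>\<^bsub>M\<^esub> v \<in> N" if "i < n" "k < n" "v \<in> carrier M" for i k v
      using that N unfolding M.prime_submodule_def by blast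
    show "\<forall>X\<in>carrier S. A \<otimes>\<^bsub>S\<^esub> X \<in> matrices_with_rows_in N"
    proof
      fix X assume X: "X \<in> carrier S"
      have "row (A \<otimes>\<^bsub>S\<^esub> X) i \<in> N" if i: "i < n" for i
        unfolding row_mult [OF A X i]
        using rows entry row_in_carrier [OF X] i by (intro submodule_combination [OF sub]) auto
      then show "A \<otimes>\<^bsub>S\<^esub> X \<in> matrices_with_rows_in N"
        using S.m_closed [OF A X] by (simp add: matrices_with_rows_in_def)
    qed
  qed
qed

text \<open>
  A left ideal above this one is again determined by its rows, and these form a submodule above \<open>L\<close>.
\<close>
lemma maximal_left_ideal_matrices_with_rows_in:
  assumes n: "n > 0" and L: "M.maximal_submodule L"
  shows "maximal_left_ideal (matrices_with_rows_in L) S"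
proof (intro maximal_left_ideal.intro maximal_left_ideal_axioms.intro)
  have sub: "submodule L R M" using L by (simp add: M.maximal_submodule_def)
  show "left_ideal (matrices_with_rows_in L) S"
    by (rule left_ideal_matrices_with_rows_in [OF sub])
  obtain v where v: "v \<in> carrier M" "v \<notin> L"
    using L M.submoduleE(1) [OF sub] unfolding M.maximal_submodule_def by blast
  have "row (single_row v) 0 = v" using row_single_row [OF v(1) n] by simp
  then have "single_row v \<notin> matrices_with_rows_in L"
    using v(2) n by (auto simp: matrices_with_rows_in_def)
  then show "carrier S \<noteq> matrices_with_rows_in L" using single_row_carrier [OF v(1)] by blast
  fix J assume J: "left_ideal J S" and LJ: "matrices_with_rows_in L \<subseteq> J" and JS: "J \<subseteq> carrier S"
  have "L \<subseteq> row_submodule J"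
  proof
    fix u assume u: "u \<in> L"
    then have uc: "u \<in> carrier M" using M.submoduleE(1) [OF sub] by blast
    then have "single_row u \<in> matrices_with_rows_in L"
      using u M.submodule_zero [OF sub]
      by (simp add: matrices_with_rows_in_def row_single_row single_row_carrier)
    then show "u \<in> row_submodule J" using uc LJ by (auto simp: row_submodule_def)
  qed
  moreover have "submodule (row_submodule J) R M" by (rule submodule_row_submodule [OF n J])
  ultimately have "row_submodule J = L \<or> row_submodule J = carrier M"
    using L unfolding M.maximal_submodule_def by blast
  moreover have J_eq: "J = {A \<in> carrier S. \<forall>i<n. row A i \<in> row_submodule J}"
    using mem_left_ideal_iff_rows [OF n J] JS by blast
  ultimately show "J = matrices_with_rows_in L \<or> J = carrier S"
    using row_in_carrier unfolding matrices_with_rows_in_def by auto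
qed

lemma semiprime_row_submodule:
  assumes n: "n > 0" and "semiprime_left_ideal I S"
  shows "semiprime_submodule (row_submodule I)"
proof -
  interpret I: semiprime_left_ideal I S by fact
  have sub: "submodule (row_submodule I) R M"
    by (rule submodule_row_submodule [OF n I.left_ideal_axioms])
  have "v \<in> row_submodule I"
    if v: "v \<in> carrier M" and mult: "\<And>k. k < n \<Longrightarrow> v $ k \<odot>\<^bsub>M\<^esub> v \<in> row_submodule I" for v
  proof -
    have vS: "single_row v \<in> carrier S" using v by (rule single_row_carrier)
    have "single_row v \<otimes>\<^bsub>S\<^esub> X \<otimes>\<^bsub>S\<^esub> single_row v \<in> I" if X: "X \<in> carrier S" for X
    proof -
      \<comment> \<open>the only entry in the first column of \<open>single_row v\<close> times \<open>X\<close> that can be nonzero\<close>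
      define c where "c = (\<Oplus>k\<in>{..<n}. v $ k \<otimes> X $$ (k, 0))"
      have vk: "v $ k \<in> carrier R" if "k < n" for k
        using v that by (simp add: row_module_carrier_iff)
      have Xk: "X $$ (k, 0) \<in> carrier R" if "k < n" for k
        using X n that by (simp add: matrix_carrier_iff)
      have vX: "single_row v \<otimes>\<^bsub>S\<^esub> X \<in> carrier S" using vS X by (rule S.m_closed)
      have "(single_row v \<otimes>\<^bsub>S\<^esub> X) $$ (i, 0) = (if i = 0 then c else \<zero>)" if i: "i < n" for i
      proof -
        have "(\<Oplus>k\<in>{..<n}. single_row v $$ (i, k) \<otimes> X $$ (k, 0)) =
            (\<Oplus>k\<in>{..<n}. if i = 0 then v $ k \<otimes> X $$ (k, 0) else \<zero>)"
          using i vk Xk by (intro finsum_cong') (auto simp: single_row_def)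
        then show ?thesis using i n by (simp add: matrix_mult c_def)
      qed
      then have "single_row v \<otimes>\<^bsub>S\<^esub> X \<otimes>\<^bsub>S\<^esub> single_row v = single_row (c \<odot>\<^bsub>M\<^esub> v)"
        unfolding mult_single_row [OF vX v n] using vk
        by (intro eq_matI) (auto simp: single_row_def row_module_simps)
      moreover have "c \<odot>\<^bsub>M\<^esub> v =
          vec n (\<lambda>j. \<Oplus>k\<in>{..<n}. X $$ (k, 0) \<otimes> (v $ k \<odot>\<^bsub>M\<^esub> v) $ j)"
      proof (rule eq_vecI)
        fix j assume "j < dim_vec (vec n (\<lambda>j. \<Oplus>k\<in>{..<n}. X $$ (k, 0) \<otimes> (v $ k \<odot>\<^bsub>M\<^esub> v) $ j))"
        then have j: "j < n" by simp
        have "c \<otimes> v $ j = (\<Oplus>k\<in>{..<n}. v $ k \<otimes> X $$ (k, 0) \<otimes> v $ j)"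
          unfolding c_def using vk Xk j by (intro finsum_ldistr) auto
        also have "\<dots> = (\<Oplus>k\<in>{..<n}. X $$ (k, 0) \<otimes> (v $ k \<odot>\<^bsub>M\<^esub> v) $ j)"
          using vk Xk j by (intro finsum_cong') (auto simp: row_module_simps m_ac)
        finally show "(c \<odot>\<^bsub>M\<^esub> v) $ j =
            vec n (\<lambda>j. \<Oplus>k\<in>{..<n}. X $$ (k, 0) \<otimes> (v $ k \<odot>\<^bsub>M\<^esub> v) $ j) $ j"
          using j by (simp add: row_module_simps)
      qed (simp add: row_module_simps)
      moreover have "\<dots> \<in> row_submodule I"
      proof (rule submodule_combination [OF sub])
        fix k assume k: "k < n"
        show "X $$ (k, 0) \<in> carrier R" using Xk [OF k] .
        then show "X $$ (k, 0) \<odot>\<^bsub>M\<^esub> (v $ k \<odot>\<^bsub>M\<^esub> v) \<in> row_submodule I"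
          using mult [OF k] by (rule M.submoduleE(4) [OF sub])
        show "v $ k \<odot>\<^bsub>M\<^esub> v \<in> carrier M" using vk [OF k] v by (rule M.smult_closed)
      qed
      ultimately show ?thesis by (simp add: row_submodule_def)
    qed
    then have "single_row v \<in> I" using vS by (rule I.I_semiprime [rotated])
    then show ?thesis using v by (simp add: row_submodule_def)
  qed
  then show ?thesis using sub unfolding semiprime_submodule_def by blast
qed

text \<open>
  Primeness of the left ideal is applied to \<open>a\<close> times the top left matrix unit and the matrix with first row
  \<open>v\<close>: a product of the two with \<open>X\<close> in between has the first row \<open>b a v\<close>, where \<open>b\<close> is the top left entry of
  \<open>X\<close>.
\<close>
lemma prime_row_submodule:
  assumes n: "n > 0" and "prime_left_ideal I S"
    and a: "a \<in> carrier R" and v: "v \<in> carrier M" and av: "a \<odot>\<^bsub>M\<^esub> v \<in> row_submodule I"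
  shows "v \<in> row_submodule I \<or> (\<forall>w\<in>carrier M. a \<odot>\<^bsub>M\<^esub> w \<in> row_submodule I)"
proof -
  interpret I: prime_left_ideal I S by fact
  define E where "E = single_row (a \<odot>\<^bsub>M\<^esub> unit_row 0)"
  have E: "E \<in> carrier S"
    unfolding E_def using a
    by (intro single_row_carrier) (auto simp: row_module_carrier_iff row_module_simps)
  have Emult: "E \<otimes>\<^bsub>S\<^esub> single_row w = single_row (a \<odot>\<^bsub>M\<^esub> w)" if "w \<in> carrier M" for w
    unfolding E_def by (rule scaled_single_row [OF n a that])
  have vS: "single_row v \<in> carrier S" using v by (rule single_row_carrier)
  have "E \<otimes>\<^bsub>S\<^esub> X \<otimes>\<^bsub>S\<^esub> single_row v \<in> I" if X: "X \<in> carrier S" for X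
  proof -
    define b where "b = X $$ (0, 0)"
    have b: "b \<in> carrier R" using X n by (simp add: b_def matrix_carrier_iff)
    have EX: "E \<otimes>\<^bsub>S\<^esub> X \<in> carrier S" using E X by (rule S.m_closed)
    have "(E \<otimes>\<^bsub>S\<^esub> X) $$ (i, 0) = (if i = 0 then a \<otimes> b else \<zero>)" if i: "i < n" for i
    proof -
      have "(\<Oplus>k\<in>{..<n}. E $$ (i, k) \<otimes> X $$ (k, 0)) =
          (\<Oplus>k\<in>{..<n}. if 0 = k then (if i = 0 then a \<otimes> X $$ (k, 0) else \<zero>) else \<zero>)"
        using i n X a
        by (intro finsum_cong') (auto simp: E_def single_row_def row_module_simps matrix_carrier_iff)
      also have "\<dots> = (if i = 0 then a \<otimes> X $$ (0, 0) else \<zero>)"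
        using n X a by (intro finsum_singleton) (auto simp: matrix_carrier_iff)
      finally show ?thesis using i n by (simp add: matrix_mult b_def)
    qed
    then have "E \<otimes>\<^bsub>S\<^esub> X \<otimes>\<^bsub>S\<^esub> single_row v = single_row (b \<odot>\<^bsub>M\<^esub> (a \<odot>\<^bsub>M\<^esub> v))"
      unfolding mult_single_row [OF EX v n] using a b v
      by (intro eq_matI) (auto simp: single_row_def row_module_simps row_module_carrier_iff m_ac)
    moreover have "b \<odot>\<^bsub>M\<^esub> (a \<odot>\<^bsub>M\<^esub> v) \<in> row_submodule I"
      using b av by (rule M.submoduleE(4) [OF submodule_row_submodule [OF n I.left_ideal_axioms]])
    ultimately show ?thesis by (simp add: row_submodule_def)
  qed
  then have "(\<forall>X\<in>carrier S. E \<otimes>\<^bsub>S\<^esub> X \<in> I) \<or> single_row v \<in> I"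
    by (rule I.I_prime [OF E vS])
  then show ?thesis
  proof
    assume *: "\<forall>X\<in>carrier S. E \<otimes>\<^bsub>S\<^esub> X \<in> I"
    have "a \<odot>\<^bsub>M\<^esub> w \<in> row_submodule I" if w: "w \<in> carrier M" for w
      using * single_row_carrier [OF w] Emult [OF w] M.smult_closed [OF a w]
      by (auto simp: row_submodule_def)
    then show ?thesis by blast
  next
    assume "single_row v \<in> I"
    then show ?thesis using v by (simp add: row_submodule_def)
  qed
qed

lemma semiprime_left_ideal_separated:
  assumes n: "n > 0" and I: "semiprime_left_ideal I S" and A: "A \<in> carrier S" "A \<notin> I"
  obtains P where "prime_left_ideal P S" "I \<subseteq> P" "A \<notin> P"
proof -
  interpret I: semiprime_left_ideal I S by fact
  note rows = mem_left_ideal_iff_rows [OF n I.left_ideal_axioms]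
  obtain i where i: "i < n" "row A i \<notin> row_submodule I" using A rows by blast
  obtain p N where p: "primeideal p R" and N: "M.prime_submodule p N" "row_submodule I \<subseteq> N"
      and iN: "row A i \<notin> N"
    using semiprime_submodule_separated_by_prime_submodule
      [OF semiprime_row_submodule [OF n I] row_in_carrier [OF A(1) i(1)] i(2)] by blast
  have "prime_left_ideal (matrices_with_rows_in N) S"
    by (rule prime_left_ideal_matrices_with_rows_in [OF N(1)])
  moreover have "I \<subseteq> matrices_with_rows_in N"
    using rows N(2) I.a_subset unfolding matrices_with_rows_in_def by blast
  moreover have "A \<notin> matrices_with_rows_in N"
    using i iN by (auto simp: matrices_with_rows_in_def)
  ultimately show ?thesis using that by blast
qed

lemma prime_left_ideal_separated:
  assumes n: "n > 0" and "jacobson_ring R"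
    and P: "prime_left_ideal P S" and A: "A \<in> carrier S" "A \<notin> P"
  obtains L where "maximal_left_ideal L S" "P \<subseteq> L" "A \<notin> L"
proof -
  interpret P: prime_left_ideal P S by fact
  note rows = mem_left_ideal_iff_rows [OF n P.left_ideal_axioms]
  obtain i where i: "i < n" "row A i \<notin> row_submodule P" using A rows by blast
  have v: "row A i \<in> carrier M" using A(1) i(1) by (rule row_in_carrier)
  have sub: "submodule (row_submodule P) R M"
    by (rule submodule_row_submodule [OF n P.left_ideal_axioms])
  have "row_submodule P \<noteq> carrier M" using v i by blast
  then obtain p where p: "primeideal p R" "M.prime_submodule p (row_submodule P)"
    using M.prime_submodule_transporter [OF sub] prime_row_submodule [OF n P] by blast
  have "finite (unit_row ` {..<n})" "unit_row ` {..<n} \<subseteq> carrier M"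
    by (auto simp: row_module_carrier_iff)
  then obtain N where N: "M.maximal_submodule N" "row_submodule P \<subseteq> N" "row A i \<notin> N"
    using M.prime_submodule_separated_by_maximal_submodule [OF assms(2) p v i(2)]
      submodule_eq_carrier_if_unit_rows by blast
  have "maximal_left_ideal (matrices_with_rows_in N) S"
    by (rule maximal_left_ideal_matrices_with_rows_in [OF n N(1)])
  moreover have "P \<subseteq> matrices_with_rows_in N"
    using rows N(2) P.a_subset unfolding matrices_with_rows_in_def by blast
  moreover have "A \<notin> matrices_with_rows_in N"
    using i N(3) by (auto simp: matrices_with_rows_in_def)
  ultimately show ?thesis using that by blast
qed

end

theorem theorem3:
  fixes R :: "('a, 'b) ring_scheme" and n :: nat
  assumes "cring R" and "n > 0"
  shows "(\<forall>I. semiprime_left_ideal I (matrix_ring R n) \<longrightarrow>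
            I = carrier (matrix_ring R n) \<inter> \<Inter>{P. prime_left_ideal P (matrix_ring R n) \<and> I \<subseteq> P})
       \<and> (jacobson_ring R \<longrightarrow>
            (\<forall>P. prime_left_ideal P (matrix_ring R n) \<longrightarrow>
              P = carrier (matrix_ring R n) \<inter>
                \<Inter>{M. maximal_left_ideal M (matrix_ring R n) \<and> P \<subseteq> M}))"
proof (intro conjI allI impI)
  interpret free_row_module R n
    using assms(1) by (rule free_row_module.intro)
  have subset: "I \<subseteq> carrier S" if "left_ideal I S" for I
    using that by (simp add: left_ideal_def additive_subgroup.a_subset)
  show "I = carrier S \<inter> \<Inter>{P. prime_left_ideal P S \<and> I \<subseteq> P}" if "semiprime_left_ideal I S" for I
    using subset [OF semiprime_left_ideal.axioms(1) [OF that]]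
      semiprime_left_ideal_separated [OF assms(2) that] by blast
  show "P = carrier S \<inter> \<Inter>{M. maximal_left_ideal M S \<and> P \<subseteq> M}"
    if "jacobson_ring R" "prime_left_ideal P S" for P
    using subset [OF prime_left_ideal.axioms(1) [OF that(2)]]
      prime_left_ideal_separated [OF assms(2) that] by blast
qed

end
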